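(* Let $L\colon[a,b]\times\mathbb{R}^n\times\mathbb{R}^n\to\mathbb{R}$ be continuous and satisfy the strict convexity condition (SC) stated in the context. Let $v\in W^{1,1}((a,b);\mathbb{R}^n)$ be a minimizer of $\mathscr{L}$ over $\mathscr{A}_{v(a),v(b)}$, and let $t\in[a,b]$. (i) If $t\in(a,b]$ and $D^-v(t)$ exists with each component finite, then $v'$ is approximately continuous on the left at $t$: for all $c>0$, \[ \lim_{s\uparrow t}(t-s)^{-1}\lambda\big(\{r\in(s,t):\|v'(r)-D^-v(t)\|\ge c\}\big)=0 . \] (ii) If $t\in[a,b)$ and $D^+v(t)$ exists with each component finite, then $v'$ is approximately continuous on the right at $t$: for all $c>0$, \[ \lim_{s\downarrow t}(s-t)^{-1}\lambda\big(\{r\in(t,s):\|v'(r)-D^+v(t)\|\ge c\}\big)=0 . \]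
   Context: $[a,b]\subseteq\mathbb{R}$, $n\ge1$, $\|\cdot\|$ is the Euclidean norm on $\mathbb{R}^n$, $\lambda$ is Lebesgue measure. Functions in $W^{1,1}((a,b);\mathbb{R}^n)$ are identified with their absolutely continuous representatives on $[a,b]$. $\mathscr{L}(u)=\int_a^bL(t,u(t),u'(t))\,dt$; $\mathscr{A}_{A,B}=\{u\in W^{1,1}((a,b);\mathbb{R}^n):u(a)=A,\ u(b)=B\}$; a minimizer of $\mathscr{L}$ over $\mathscr{A}_{v(a),v(b)}$ is $v$ with $\mathscr{L}(v)\le\mathscr{L}(u)$ for all $u\in\mathscr{A}_{v(a),v(b)}$. Condition (SC): for all $R\in[1,\infty)$ there exists $\tau_R>0$ such that for all $(t,y,p)\in[a,b]\times\mathbb{R}^n\times\mathbb{R}^n$ with $\max\{|t|,\|y\|,\|p\|\}\le R+1$ there exists a subdifferential (subgradient) $\xi\in\mathbb{R}^n$ of $L(t,y,\cdot)$ at $p$ (i.e. $L(t,y,q)\ge L(t,y,p)+\xi\cdot(q-p)$ for all $q\in\mathbb{R}^n$) such that $L(t,y,q)\ge L(t,y,p)+\xi\cdot(q-p)+2\tau_R$ whenever $\|q-p\|\ge R^{-1}$. One-sided derivatives: for scalar $v$, $D^-v(t)=\lim_{s\uparrow t}\frac{v(s)-v(t)}{s-t}$ and $D^+v(t)=\lim_{s\downarrow t}\frac{v(s)-v(t)}{s-t}$, whenever these limits make sense and exist as finite or infinite values; for vector-valued $v$ they are formed componentwise and exist iff they exist for each component. *)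

theory Defs
  imports "HOL-Analysis.Analysis"
begin

definition abs_cont_on :: "real \<Rightarrow> real \<Rightarrow> (real \<Rightarrow> 'a::real_normed_vector) \<Rightarrow> bool" where
  "abs_cont_on a b u \<longleftrightarrow>
     (\<forall>\<epsilon>>0. \<exists>\<delta>>0. \<forall>I :: (real \<times> real) set.
        finite I \<and> (\<forall>(x, y)\<in>I. a \<le> x \<and> x \<le> y \<and> y \<le> b) \<and>
        disjoint_family_on (\<lambda>(x, y). {x<..<y}) I \<and> (\<Sum>(x, y)\<in>I. y - x) < \<delta>
        \<longrightarrow> (\<Sum>(x, y)\<in>I. norm (u y - u x)) < \<epsilon>)"

(* Test functions are C^1 with compact support in (a,b).  Testing against smooth functions instead
   yields the same weak derivatives, by mollification. *)
definition test_fun :: "real \<Rightarrow> real \<Rightarrow> (real \<Rightarrow> real) \<Rightarrow> bool" where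
  "test_fun a b \<phi> \<longleftrightarrow> \<phi> C1_differentiable_on UNIV \<and>
     compact (closure {x. \<phi> x \<noteq> 0}) \<and> closure {x. \<phi> x \<noteq> 0} \<subseteq> {a<..<b}"

definition is_weak_deriv ::
    "real \<Rightarrow> real \<Rightarrow> (real \<Rightarrow> real ^ 'n) \<Rightarrow> (real \<Rightarrow> real ^ 'n) \<Rightarrow> bool" where
  "is_weak_deriv a b u g \<longleftrightarrow> set_integrable lebesgue {a<..<b} g \<and>
     (\<forall>\<phi>. test_fun a b \<phi> \<longrightarrow>
        (LINT x:{a<..<b}|lebesgue. deriv \<phi> x *\<^sub>R u x) =
        - (LINT x:{a<..<b}|lebesgue. \<phi> x *\<^sub>R g x))"

(* An element of the Sobolev space is represented by its absolutely continuous representative on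
   [a,b]; only the values on [a,b] matter.  Integrability of u itself follows from continuity. *)
definition W11 :: "real \<Rightarrow> real \<Rightarrow> (real \<Rightarrow> real ^ 'n) set" where
  "W11 a b = {u. abs_cont_on a b u \<and> (\<exists>g. is_weak_deriv a b u g)}"

(* The weak derivative is determined only up to a null set; one version is chosen. *)
definition weak_deriv :: "real \<Rightarrow> real \<Rightarrow> (real \<Rightarrow> real ^ 'n) \<Rightarrow> real \<Rightarrow> real ^ 'n" where
  "weak_deriv a b u = (SOME g. is_weak_deriv a b u g)"

(* Integral of the positive part minus integral of the negative part, with values in the extended
   reals; ennreal truncates negative numbers to 0.  For u in W11 and L continuous with convex
   L t y for each t and y, the negative part is integrable, so infinity - infinity does not occur. *)
definition action ::
    "real \<Rightarrow> real \<Rightarrow> (real \<Rightarrow> real ^ 'n \<Rightarrow> real ^ 'n \<Rightarrow> real) \<Rightarrow> (real \<Rightarrow> real ^ 'n) \<Rightarrow> ereal" where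
  "action a b L u =
     enn2ereal (\<integral>\<^sup>+t\<in>{a<..<b}. ennreal (L t (u t) (weak_deriv a b u t)) \<partial>lebesgue) -
     enn2ereal (\<integral>\<^sup>+t\<in>{a<..<b}. ennreal (- L t (u t) (weak_deriv a b u t)) \<partial>lebesgue)"

definition admissible ::
    "real \<Rightarrow> real \<Rightarrow> real ^ 'n \<Rightarrow> real ^ 'n \<Rightarrow> (real \<Rightarrow> real ^ 'n) set" where
  "admissible a b A B = {u \<in> W11 a b. u a = A \<and> u b = B}"

definition is_minimizer ::
    "real \<Rightarrow> real \<Rightarrow> (real \<Rightarrow> real ^ 'n \<Rightarrow> real ^ 'n \<Rightarrow> real) \<Rightarrow> (real \<Rightarrow> real ^ 'n) \<Rightarrow> bool" where
  "is_minimizer a b L v \<longleftrightarrow> v \<in> admissible a b (v a) (v b) \<and>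
     (\<forall>u \<in> admissible a b (v a) (v b). action a b L v \<le> action a b L u)"

definition is_subgradient :: "(real ^ 'n \<Rightarrow> real) \<Rightarrow> real ^ 'n \<Rightarrow> real ^ 'n \<Rightarrow> bool" where
  "is_subgradient f p \<xi> \<longleftrightarrow> (\<forall>q. f q \<ge> f p + \<xi> \<bullet> (q - p))"

definition strict_convexity_SC ::
    "real \<Rightarrow> real \<Rightarrow> (real \<Rightarrow> real ^ 'n \<Rightarrow> real ^ 'n \<Rightarrow> real) \<Rightarrow> bool" where
  "strict_convexity_SC a b L \<longleftrightarrow>
     (\<forall>R\<ge>1. \<exists>\<tau>>0. \<forall>t\<in>{a..b}. \<forall>y p. max \<bar>t\<bar> (max (norm y) (norm p)) \<le> R + 1 \<longrightarrow>
        (\<exists>\<xi>. is_subgradient (L t y) p \<xi> \<and>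
             (\<forall>q. norm (q - p) \<ge> inverse R \<longrightarrow>
                  L t y q \<ge> L t y p + \<xi> \<bullet> (q - p) + 2 * \<tau>)))"

(* One-sided derivatives of vector-valued functions are taken componentwise, and each component
   may be infinite. *)
definition has_left_deriv :: "(real \<Rightarrow> real ^ 'n) \<Rightarrow> ereal ^ 'n \<Rightarrow> real \<Rightarrow> bool" where
  "has_left_deriv v d t \<longleftrightarrow>
     (\<forall>i. ((\<lambda>s. ereal ((v s $ i - v t $ i) / (s - t))) \<longlongrightarrow> d $ i) (at_left t))"

definition has_right_deriv :: "(real \<Rightarrow> real ^ 'n) \<Rightarrow> ereal ^ 'n \<Rightarrow> real \<Rightarrow> bool" where
  "has_right_deriv v d t \<longleftrightarrow>
     (\<forall>i. ((\<lambda>s. ereal ((v s $ i - v t $ i) / (s - t))) \<longlongrightarrow> d $ i) (at_right t))"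

end

theory Submission
  imports Defs
begin

text \<open>The proof compares \<open>v\<close> with the function \<open>cut_corner v x y\<close> that follows the chord of \<open>v\<close> on a short
  interval \<open>[x, y]\<close> containing \<open>t\<close>. Let \<open>p\<close> be the one-sided derivative and let \<open>\<xi>\<close> be the subgradient of
  \<open>L t (v t)\<close> at \<open>p\<close> provided by (SC). If \<open>[x, y]\<close> starts or ends at \<open>t\<close>, on the side of the one-sided
  derivative, the slope of the chord is close to \<open>p\<close>, and by continuity of \<open>L\<close> the chord costs at most \<open>L t (v t) p + \<epsilon>\<close> per unit
  of time. For \<open>v\<close> itself, (SC) suggests the lower bound
  \<open>L t (v t) p - \<epsilon> + \<xi> \<bullet> (v' r - p)\<close> for the integrand, improved by \<open>\<tau>\<close> at every time \<open>r\<close> at which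
  \<open>v' r\<close> is at distance at least \<open>c\<close> from \<open>p\<close>. The integral of the linear term is \<open>y - x\<close> times the product
  of \<open>\<xi>\<close> with the slope of the chord minus \<open>p\<close>, hence small compared with \<open>y - x\<close>. Minimality of \<open>v\<close>
  therefore bounds the measure of the bad times by a small multiple of \<open>y - x\<close>; this is
  \<open>measure_derivative_far_small\<close>.

  The delicate point is that the same \<open>\<xi>\<close> must serve at all times near \<open>t\<close>. The derivative of \<open>v\<close> is
  merely integrable, so with a varying subgradient the linear term could not be controlled. The lower
  bound with a fixed \<open>\<xi>\<close> is \<open>uniform_strict_convexity\<close>: for velocities in a ball around \<open>p\<close> it follows from
  uniform continuity of \<open>L\<close>, and convexity propagates it from the sphere to all larger velocities
  (\<open>excess_outside_ball\<close>).

  The comparison needs some facts about Sobolev functions of one variable, all derived from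
  \<open>weak_integration_by_parts\<close>: the integral of the weak derivative is the increment, weak derivatives are
  unique almost everywhere, and the competitor is admissible with the expected derivative. Moreover the
  action of \<open>v\<close> must be finite, so that the contribution outside \<open>[x, y]\<close> cancels; see
  \<open>integrand_integrable\<close>.\<close>

section \<open>A continuously differentiable step\<close>

text \<open>A continuous tent of total mass one on the unit interval. It and its primitive \<open>ramp\<close> are
  written with positive parts, so that differentiability reduces to that of the square of the
  positive part and no piecewise definition has to be glued.\<close>
definition bump :: "real \<Rightarrow> real" where
  "bump x = 4 * (max 0 x - 2 * max 0 (x - 1/2) + max 0 (x - 1))"

definition ramp :: "real \<Rightarrow> real" where
  "ramp x = 2 * ((max 0 x)\<^sup>2 - 2 * (max 0 (x - 1/2))\<^sup>2 + (max 0 (x - 1))\<^sup>2)"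

lemma max0_square_has_derivative:
  "((\<lambda>x::real. (max 0 x)\<^sup>2) has_real_derivative 2 * max 0 x) (at x)"
proof -
  consider "x < 0" | "x > 0" | "x = 0" by linarith
  then show ?thesis
  proof cases
    case 1
    have "((\<lambda>x::real. 0) has_real_derivative 2 * max 0 x) (at x)"
      using 1 by (auto intro!: derivative_eq_intros)
    then show ?thesis
      by (rule has_field_derivative_transform_within_open[of _ _ _ "{..<0}"]) (use 1 in auto)
  next
    case 2
    have "((\<lambda>x::real. x\<^sup>2) has_real_derivative 2 * max 0 x) (at x)"
      using 2 by (auto intro!: derivative_eq_intros)
    then show ?thesis
      by (rule has_field_derivative_transform_within_open[of _ _ _ "{0<..}"]) (use 2 in auto)
  next
    case 3
    have "((\<lambda>h::real. (max 0 h)\<^sup>2 / h) \<longlongrightarrow> 0) (at 0)"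
    proof (rule tendsto_0_le[where K = 1])
      show "((\<lambda>h::real. h) \<longlongrightarrow> 0) (at 0)" by simp
      have "norm ((max 0 h)\<^sup>2 / h) \<le> norm h * 1" for h :: real
        by (cases "h = 0") (auto simp: max_def power2_eq_square)
      then show "\<forall>\<^sub>F h in at 0. norm ((max 0 h)\<^sup>2 / h) \<le> norm (h::real) * 1"
        by simp
    qed
    with 3 show ?thesis
      by (simp add: DERIV_def)
  qed
qed

lemma ramp_has_derivative: "(ramp has_real_derivative bump x) (at x)"
proof -
  have shift: "((\<lambda>x::real. (max 0 (x - c))\<^sup>2) has_real_derivative 2 * max 0 (x - c)) (at x)" for c
  proof -
    have "((\<lambda>x::real. x - c) has_real_derivative 1) (at x)"
      by (auto intro!: derivative_eq_intros)
    from DERIV_chain2[OF max0_square_has_derivative this] show ?thesis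
      by simp
  qed
  show ?thesis
    unfolding ramp_def bump_def
    using DERIV_cmult[OF DERIV_add[OF DERIV_diff[OF shift[of 0]
        DERIV_cmult[OF shift[of "1/2"], of 2]] shift[of 1]], of 2]
    by (simp add: algebra_simps)
qed

lemma ramp_eq_0: "x \<le> 0 \<Longrightarrow> ramp x = 0"
  by (simp add: ramp_def)

lemma ramp_eq_1: "1 \<le> x \<Longrightarrow> ramp x = 1"
  by (simp add: ramp_def power2_eq_square algebra_simps)

lemma bump_nonneg: "0 \<le> bump x"
  by (auto simp: bump_def max_def)

lemma bump_eq_0: "x \<notin> {0..1} \<Longrightarrow> bump x = 0"
  by (auto simp: bump_def max_def)

lemma continuous_on_bump [continuous_intros]:
  "continuous_on S f \<Longrightarrow> continuous_on S (\<lambda>x. bump (f x))"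
  unfolding bump_def by (intro continuous_intros)

lemma ramp_bounds: "0 \<le> ramp x" "ramp x \<le> 1"
proof -
  have mono: "ramp u \<le> ramp w" if "u \<le> w" for u w
  proof (rule DERIV_nonneg_imp_nondecreasing[OF that])
    show "\<exists>y. (ramp has_real_derivative y) (at x) \<and> 0 \<le> y" for x
      using ramp_has_derivative[of x] bump_nonneg[of x] by auto
  qed
  show "0 \<le> ramp x"
    using mono[of 0 x] ramp_eq_0[of 0] ramp_eq_0[of x] by linarith
  show "ramp x \<le> 1"
    using mono[of x 1] ramp_eq_1[of 1] ramp_eq_1[of x] by linarith
qed

lemma bump_integral: "integrable lebesgue bump" "(LINT x|lebesgue. bump x) = 1"
proof -
  have eq: "indicator {0..1} x *\<^sub>R bump x = bump x" for x
    using bump_eq_0[of x] by (auto simp: indicator_def)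
  have int: "set_integrable lebesgue {0..1} bump"
    by (intro absolutely_integrable_continuous_real continuous_intros)
  then show "integrable lebesgue bump"
    unfolding set_integrable_def eq by simp
  have "(bump has_integral ramp 1 - ramp 0) {0..1}"
    by (intro fundamental_theorem_of_calculus)
       (simp_all add: has_field_derivative_at_within[OF ramp_has_derivative]
         flip: has_real_derivative_iff_has_vector_derivative)
  then have "(LINT x:{0..1}|lebesgue. bump x) = 1"
    using set_lebesgue_integral_eq_integral(2)[OF int] by (simp add: integral_unique ramp_eq_0 ramp_eq_1)
  then show "(LINT x|lebesgue. bump x) = 1"
    unfolding set_lebesgue_integral_def eq .
qed

text \<open>The rescaled tents have mass one and concentrate at \<open>z\<close>. The parameter \<open>k\<close> shifts their supports
  to one side of \<open>z\<close>: at an end point of the interval the tents must stay inside it, and then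
  one-sided continuity of \<open>\<psi>\<close> suffices. After rescaling this is dominated convergence.\<close>
lemma approximate_identity_at_edge:
  fixes \<psi> :: "real \<Rightarrow> 'b::euclidean_space"
  assumes cont: "continuous_on {a..b} \<psi>" and z: "z \<in> {a..b}"
    and inside: "\<And>u. u \<in> {0..1} \<Longrightarrow> eventually (\<lambda>n. z + (u - k) / real n \<in> {a<..<b}) sequentially"
  shows "(\<lambda>n. LINT r:{a<..<b}|lebesgue. (real n * bump (real n * (r - z) + k)) *\<^sub>R \<psi> r)
           \<longlonglongrightarrow> \<psi> z"
proof -
  let ?S = "{a<..<b}"
  define F where "F n u = bump u *\<^sub>R (indicator ?S (z + (u - k) / real n) *\<^sub>R \<psi> (z + (u - k) / real n))"
    for n :: nat and u
  obtain M where M: "\<And>r. r \<in> {a..b} \<Longrightarrow> norm (\<psi> r) \<le> M"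
    using compact_imp_bounded[OF compact_continuous_image[OF cont compact_Icc]]
    unfolding bounded_iff by (meson imageI)
  have subst: "(LINT r:?S|lebesgue. (real n * bump (real n * (r - z) + k)) *\<^sub>R \<psi> r)
      = (LINT u|lebesgue. F n u)" if "n > 0" for n
  proof -
    have arg: "z - k / real n + 1 / real n * u = z + (u - k) / real n" for u
      by (simp add: diff_divide_distrib)
    have cancel: "real n * (z + (u - k) / real n - z) + k = u" for u
      using that by simp
    have "(LINT r|lebesgue. indicator ?S r *\<^sub>R ((real n * bump (real n * (r - z) + k)) *\<^sub>R \<psi> r))
       = \<bar>1 / real n\<bar> *\<^sub>R (LINT u|lebesgue. real n *\<^sub>R F n u)"
      using that
      by (subst lebesgue_integral_real_affine[where c = "1 / real n" and t = "z - k / real n"])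
         (simp, simp only: arg cancel F_def, simp add: mult_ac)
    with that show ?thesis
      by (simp add: set_lebesgue_integral_def)
  qed
  have meas: "F n \<in> borel_measurable lebesgue" for n
  proof -
    have "(\<lambda>r. indicator ?S r *\<^sub>R \<psi> r) \<in> borel_measurable borel"
      by (intro borel_measurable_continuous_on_indicator)
         (auto intro: continuous_on_subset[OF cont])
    moreover have "(\<lambda>u. z + (u - k) / real n) \<in> borel_measurable borel"
      by simp
    moreover have "bump \<in> borel_measurable borel"
      by (intro borel_measurable_continuous_onI continuous_intros)
    ultimately have "F n \<in> borel_measurable borel"
      unfolding F_def by measurable
    then show ?thesis
      by (simp add: measurable_completion)
  qed
  have "(\<lambda>n. LINT u|lebesgue. F n u) \<longlonglongrightarrow> (LINT u|lebesgue. bump u *\<^sub>R \<psi> z)"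
  proof (rule integral_dominated_convergence[where w = "\<lambda>u. M * bump u"])
    show "(\<lambda>u. bump u *\<^sub>R \<psi> z) \<in> borel_measurable lebesgue"
      using borel_measurable_integrable[OF bump_integral(1)] by measurable
    show "integrable lebesgue (\<lambda>u. M * bump u)"
      using bump_integral(1) by simp
    show "AE u in lebesgue. (\<lambda>n. F n u) \<longlonglongrightarrow> bump u *\<^sub>R \<psi> z"
    proof (rule AE_I2)
      fix u :: real
      show "(\<lambda>n. F n u) \<longlonglongrightarrow> bump u *\<^sub>R \<psi> z"
      proof (cases "u \<in> {0..1}")
        case False
        then show ?thesis by (simp add: F_def bump_eq_0)
      next
        case True
        have lim: "(\<lambda>n. z + (u - k) / real n) \<longlonglongrightarrow> z"
          using tendsto_add[OF tendsto_const lim_const_over_n[of "u - k"], of z] by simp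
        have ev: "\<forall>\<^sub>F n in sequentially. z + (u - k) / real n \<in> {a..b}"
          using inside[OF True] by eventually_elim auto
        have "(\<lambda>n. bump u *\<^sub>R \<psi> (z + (u - k) / real n)) \<longlonglongrightarrow> bump u *\<^sub>R \<psi> z"
          by (intro tendsto_intros continuous_on_tendsto_compose[OF cont lim z ev])
        moreover have "\<forall>\<^sub>F n in sequentially. bump u *\<^sub>R \<psi> (z + (u - k) / real n) = F n u"
          using inside[OF True] by eventually_elim (simp add: F_def)
        ultimately show ?thesis
          by (rule Lim_transform_eventually)
      qed
    qed
    show "AE u in lebesgue. norm (F n u) \<le> M * bump u" for n
    proof (rule AE_I2)
      fix u
      have "norm (indicator ?S (z + (u - k) / real n) *\<^sub>R \<psi> (z + (u - k) / real n)) \<le> M"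
        using M[of "z + (u - k) / real n"] M[OF z] norm_ge_zero[of "\<psi> z"]
        by (auto simp: indicator_def simp del: norm_ge_zero)
      then show "norm (F n u) \<le> M * bump u"
        using mult_right_mono[OF _ bump_nonneg[of u]]
        by (fastforce simp: F_def bump_nonneg mult_ac)
    qed
  qed (rule meas)
  also have "(LINT u|lebesgue. bump u *\<^sub>R \<psi> z) = \<psi> z"
    using bump_integral by simp
  finally show ?thesis
    by (rule Lim_transform_eventually)
       (use subst in \<open>auto intro: eventually_mono[OF eventually_gt_at_top[of 0]]\<close>)
qed

section \<open>Integration by parts for weak derivatives\<close>

text \<open>A \<open>C\<^sup>1\<close> approximation of the indicator of the interval from \<open>x\<close> to \<open>y\<close>. It climbs between
  \<open>x + 1/n\<close> and \<open>x + 2/n\<close> and descends between \<open>y - 2/n\<close> and \<open>y - 1/n\<close>. Both ramps lie inside, so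
  its product with a \<open>C\<^sup>1\<close> function is an admissible test function even when \<open>x = a\<close> or \<open>y = b\<close>.\<close>
definition cutoff :: "real \<Rightarrow> real \<Rightarrow> nat \<Rightarrow> real \<Rightarrow> real" where
  "cutoff x y n r = ramp (real n * (r - x) - 1) - ramp (real n * (r - y) + 2)"

definition cutoff_deriv :: "real \<Rightarrow> real \<Rightarrow> nat \<Rightarrow> real \<Rightarrow> real" where
  "cutoff_deriv x y n r =
     real n * bump (real n * (r - x) - 1) - real n * bump (real n * (r - y) + 2)"

lemma cutoff_has_derivative:
  "(cutoff x y n has_real_derivative cutoff_deriv x y n r) (at r)"
proof -
  have affine: "((\<lambda>r. ramp (real n * (r - z) + k)) has_real_derivative
      bump (real n * (r - z) + k) * real n) (at r)" for z k
  proof -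
    have "((\<lambda>r. real n * (r - z) + k) has_real_derivative real n) (at r)"
      by (auto intro!: derivative_eq_intros)
    from DERIV_chain2[OF ramp_has_derivative this] show ?thesis .
  qed
  show ?thesis
    using DERIV_diff[OF affine[of x "-1"] affine[of y 2]]
    by (simp add: cutoff_def[abs_def] cutoff_deriv_def mult.commute)
qed

lemma cutoff_bound: "\<bar>cutoff x y n r\<bar> \<le> 1"
  using ramp_bounds[of "real n * (r - x) - 1"] ramp_bounds[of "real n * (r - y) + 2"]
  by (simp add: cutoff_def abs_le_iff)

text \<open>For \<open>n * (y - x) > 3\<close> the ascent is over before the descent begins, so the two ramps cancel to the
  right of \<open>y - 1/n\<close> and both vanish to the left of \<open>x + 1/n\<close>.\<close>
lemma cutoff_eq_0:
  assumes "x \<le> y" "3 < real n * (y - x)" "r \<notin> {x + 1 / real n..y - 1 / real n}"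
  shows "cutoff x y n r = 0"
proof -
  have n: "real n > 0"
    using assms(1,2) by (cases n) auto
  from assms(3) consider "r < x + 1 / real n" | "r > y - 1 / real n" by force
  then show ?thesis
  proof cases
    case 1
    then have "real n * (r - x) \<le> 1"
      using n by (simp add: field_simps)
    moreover have "real n * (r - y) = real n * (r - x) - real n * (y - x)"
      by (simp add: algebra_simps)
    ultimately show ?thesis
      using assms(2) by (simp add: cutoff_def ramp_eq_0)
  next
    case 2
    then have "-1 \<le> real n * (r - y)"
      using n by (simp add: field_simps)
    moreover have "real n * (r - x) = real n * (r - y) + real n * (y - x)"
      by (simp add: algebra_simps)
    ultimately show ?thesis
      using assms(2) by (simp add: cutoff_def ramp_eq_1)
  qed
qed

lemma eventually_real_mult_gt:
  assumes "0 < d"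
  shows "\<forall>\<^sub>F n in sequentially. C < real n * (d::real)"
  using filterlim_real_sequentially
  by (auto simp: filterlim_at_top_dense pos_divide_less_eq[OF assms] dest!: spec[of _ "C / d"])

lemma cutoff_tendsto:
  assumes "x < y"
  shows "(\<lambda>n. cutoff x y n r) \<longlonglongrightarrow> indicator {x<..<y} r"
proof (cases "r \<in> {x<..<y}")
  case True
  then have "\<forall>\<^sub>F n in sequentially. 2 < real n * (r - x)"
    "\<forall>\<^sub>F n in sequentially. 2 < real n * (y - r)"
    by (auto intro!: eventually_real_mult_gt)
  then have "\<forall>\<^sub>F n in sequentially. cutoff x y n r = 1"
  proof eventually_elim
    case (elim n)
    have "real n * (r - y) = - (real n * (y - r))"
      by (simp add: algebra_simps)
    with elim show ?case
      by (simp add: cutoff_def ramp_eq_0 ramp_eq_1)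
  qed
  with True show ?thesis
    by (simp add: tendsto_eventually)
next
  case False
  have "\<forall>\<^sub>F n in sequentially. 3 < real n * (y - x)"
    using assms by (intro eventually_real_mult_gt) simp
  then have "\<forall>\<^sub>F n in sequentially. cutoff x y n r = 0"
  proof eventually_elim
    case (elim n)
    then have n: "real n > 0" by (cases n) auto
    then have "1 / real n > 0" by simp
    with False have "r \<notin> {x + 1 / real n..y - 1 / real n}"
      unfolding atLeastAtMost_iff greaterThanLessThan_iff by linarith
    then show ?case
      using assms elim by (intro cutoff_eq_0) auto
  qed
  with False show ?thesis
    by (simp add: tendsto_eventually)
qed

lemma integral_cutoff_tendsto:
  fixes f :: "real \<Rightarrow> 'b::euclidean_space"
  assumes f: "set_integrable lebesgue {a<..<b} f" and xy: "a \<le> x" "x < y" "y \<le> b"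
  shows "(\<lambda>n. LINT r:{a<..<b}|lebesgue. cutoff x y n r *\<^sub>R f r)
           \<longlonglongrightarrow> (LINT r:{x<..<y}|lebesgue. f r)"
    and "set_integrable lebesgue {a<..<b} (\<lambda>r. cutoff x y n r *\<^sub>R f r)"
proof -
  define h where "h r = indicator {a<..<b} r *\<^sub>R f r" for r
  have h: "integrable lebesgue h"
    using f by (simp add: set_integrable_def h_def[abs_def])
  have cutoff_meas: "cutoff x y n \<in> borel_measurable lebesgue" for n
  proof -
    have "continuous_on UNIV (cutoff x y n)"
      using cutoff_has_derivative by (meson DERIV_continuous_on has_field_derivative_at_within)
    then have "cutoff x y n \<in> borel_measurable borel"
      by (rule borel_measurable_continuous_onI)
    then show ?thesis
      by (simp add: measurable_completion)
  qed
  have meas: "(\<lambda>r. cutoff x y n r *\<^sub>R h r) \<in> borel_measurable lebesgue" for n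
    using cutoff_meas[of n] borel_measurable_integrable[OF h] by measurable
  have bound: "norm (cutoff x y n r *\<^sub>R h r) \<le> norm (h r)" for n r
    using mult_right_mono[OF cutoff_bound[of x y n r], of "norm (h r)"] by simp
  have "(\<lambda>n. LINT r|lebesgue. cutoff x y n r *\<^sub>R h r)
          \<longlonglongrightarrow> (LINT r|lebesgue. indicator {x<..<y} r *\<^sub>R h r)"
  proof (rule integral_dominated_convergence[where w = "\<lambda>r. norm (h r)"])
    show "(\<lambda>r. indicator {x<..<y} r *\<^sub>R h r) \<in> borel_measurable lebesgue"
      by (intro borel_measurable_integrable integrable_mult_indicator h) simp
  qed (use h bound meas cutoff_tendsto[OF xy(2)] in \<open>auto intro!: tendsto_intros\<close>)
  moreover have "indicator {x<..<y} r *\<^sub>R h r = indicator {x<..<y} r *\<^sub>R f r"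
    and "indicator {a<..<b} r *\<^sub>R (cutoff x y n r *\<^sub>R f r) = cutoff x y n r *\<^sub>R h r" for n r
    using xy by (auto simp: h_def indicator_def)
  ultimately show "(\<lambda>n. LINT r:{a<..<b}|lebesgue. cutoff x y n r *\<^sub>R f r)
           \<longlonglongrightarrow> (LINT r:{x<..<y}|lebesgue. f r)"
    unfolding set_lebesgue_integral_def by (simp only:)
  have "integrable lebesgue (\<lambda>r. cutoff x y n r *\<^sub>R h r)"
    by (rule Bochner_Integration.integrable_bound[OF h meas]) (use bound in auto)
  then show "set_integrable lebesgue {a<..<b} (\<lambda>r. cutoff x y n r *\<^sub>R f r)"
    by (simp add: set_integrable_def h_def mult.commute)
qed

lemma integral_cutoff_deriv_tendsto:
  fixes \<psi> :: "real \<Rightarrow> 'b::euclidean_space"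
  assumes cont: "continuous_on {a..b} \<psi>" and xy: "a \<le> x" "x < y" "y \<le> b"
  shows "(\<lambda>n. LINT r:{a<..<b}|lebesgue. cutoff_deriv x y n r *\<^sub>R \<psi> r) \<longlonglongrightarrow> \<psi> x - \<psi> y"
proof -
  have edge: "(\<lambda>n. LINT r:{a<..<b}|lebesgue. (real n * bump (real n * (r - z) + k)) *\<^sub>R \<psi> r)
           \<longlonglongrightarrow> \<psi> z"
    if zk: "z = x \<and> k = -1 \<or> z = y \<and> k = 2" for z k :: real
  proof (rule approximate_identity_at_edge[OF cont])
    show "z \<in> {a..b}" using zk xy by auto
    fix u :: real assume u: "u \<in> {0..1}"
    have "\<forall>\<^sub>F n in sequentially. 2 < real n * (y - x)"
      using xy by (intro eventually_real_mult_gt) simp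
    then show "\<forall>\<^sub>F n in sequentially. z + (u - k) / real n \<in> {a<..<b}"
    proof eventually_elim
      case (elim n)
      then have n: "real n > 0" by (cases n) auto
      have lim: "2 / real n < y - x"
        using elim n by (simp add: field_simps)
      from zk show ?case
      proof
        assume "z = x \<and> k = -1"
        moreover have "0 < (u + 1) / real n" "(u + 1) / real n \<le> 2 / real n"
          using u n by (auto intro: divide_right_mono)
        ultimately show ?thesis using lim xy by auto
      next
        assume "z = y \<and> k = 2"
        moreover have "0 < (2 - u) / real n" "(2 - u) / real n \<le> 2 / real n"
          using u n by (auto intro: divide_right_mono)
        moreover have "(u - 2) / real n = - ((2 - u) / real n)"
          by (simp add: minus_divide_left)
        ultimately show ?thesis using lim xy by auto
      qed
    qed
  qed
  have int: "set_integrable lebesgue {a<..<b} (\<lambda>r. (real n * bump (real n * (r - z) + k)) *\<^sub>R \<psi> r)"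
    for n z k
  proof (rule set_integrable_subset)
    show "set_integrable lebesgue {a..b} (\<lambda>r. (real n * bump (real n * (r - z) + k)) *\<^sub>R \<psi> r)"
      by (intro absolutely_integrable_continuous_real continuous_intros cont)
  qed auto
  show ?thesis
    using tendsto_diff[OF edge[of x "-1"] edge[of y 2]] int[of _ x "-1"] int[of _ y 2]
    by (simp add: cutoff_deriv_def scaleR_diff_left set_integral_diff)
qed

lemma set_integrable_continuous_scaleR:
  fixes g :: "real \<Rightarrow> 'b::euclidean_space"
  assumes \<phi>: "continuous_on UNIV \<phi>" and g: "set_integrable lebesgue {a<..<b} g"
  shows "set_integrable lebesgue {a<..<b} (\<lambda>r. \<phi> r *\<^sub>R g r)"
proof -
  obtain M where M: "\<And>r. r \<in> {a..b} \<Longrightarrow> norm (\<phi> r) \<le> M"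
    using compact_imp_bounded[OF compact_continuous_image[OF continuous_on_subset[OF \<phi>] compact_Icc]]
    unfolding bounded_iff by (meson imageI subset_UNIV)
  have "\<phi> \<in> borel_measurable lebesgue"
    by (intro measurable_completion) (simp add: borel_measurable_continuous_onI \<phi>)
  moreover have "(\<lambda>r. indicator {a<..<b} r *\<^sub>R g r) \<in> borel_measurable lebesgue"
    using g unfolding set_integrable_def by (rule borel_measurable_integrable)
  ultimately have "(\<lambda>r. \<phi> r *\<^sub>R (indicator {a<..<b} r *\<^sub>R g r)) \<in> borel_measurable lebesgue"
    by measurable
  then have "integrable lebesgue (\<lambda>r. \<phi> r *\<^sub>R (indicator {a<..<b} r *\<^sub>R g r))"
  proof (rule Bochner_Integration.integrable_bound[rotated])
    show "integrable lebesgue (\<lambda>r. M * norm (indicator {a<..<b} r *\<^sub>R g r))"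
      using g unfolding set_integrable_def by (intro integrable_mult_right integrable_norm)
    show "AE r in lebesgue. norm (\<phi> r *\<^sub>R (indicator {a<..<b} r *\<^sub>R g r))
            \<le> norm (M * norm (indicator {a<..<b} r *\<^sub>R g r))"
    proof (rule AE_I2)
      fix r
      show "norm (\<phi> r *\<^sub>R (indicator {a<..<b} r *\<^sub>R g r))
            \<le> norm (M * norm (indicator {a<..<b} r *\<^sub>R g r))"
        using mult_right_mono[OF M[of r] norm_ge_zero[of "g r"]]
        by (auto simp: indicator_def)
    qed
  qed
  then show ?thesis
    by (simp add: set_integrable_def mult.commute)
qed

text \<open>The definition of a weak derivative only involves test functions that vanish near the end points.
  Testing with the product of \<open>\<phi>\<close> and a cutoff, whose derivative converges to the difference of
  the point evaluations at \<open>x\<close> and \<open>y\<close>, gives the boundary terms in the limit. The choice \<open>\<phi> = 1\<close>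
  is the fundamental theorem of calculus.\<close>
lemma weak_integration_by_parts:
  assumes g: "is_weak_deriv a b v g" and v: "continuous_on {a..b} v"
    and xy: "a \<le> x" "x < y" "y \<le> b"
    and \<phi>: "\<And>r. (\<phi> has_real_derivative \<phi>' r) (at r)" and \<phi>': "continuous_on UNIV \<phi>'"
  shows "(LINT r:{x<..<y}|lebesgue. \<phi>' r *\<^sub>R v r)
           = \<phi> y *\<^sub>R v y - \<phi> x *\<^sub>R v x - (LINT r:{x<..<y}|lebesgue. \<phi> r *\<^sub>R g r)"
proof -
  have cont_\<phi>: "continuous_on S \<phi>" for S
    using \<phi> by (meson DERIV_continuous_on has_field_derivative_at_within)
  have cont_\<phi>': "continuous_on S \<phi>'" for S
    using \<phi>' continuous_on_subset by blast
  have int_v: "set_integrable lebesgue {a<..<b} (\<lambda>r. \<phi>' r *\<^sub>R v r)"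
    by (rule set_integrable_subset[of _ "{a..b}"])
       (auto intro!: absolutely_integrable_continuous_real continuous_intros v cont_\<phi>')
  have int_g: "set_integrable lebesgue {a<..<b} (\<lambda>r. \<phi> r *\<^sub>R g r)"
    using g by (intro set_integrable_continuous_scaleR cont_\<phi>) (simp add: is_weak_deriv_def)
  have test: "test_fun a b (\<lambda>r. cutoff x y n r * \<phi> r)"
    and deriv: "deriv (\<lambda>r. cutoff x y n r * \<phi> r) r = cutoff_deriv x y n r * \<phi> r + cutoff x y n r * \<phi>' r"
    if n: "3 < real n * (y - x)" for n r
  proof -
    have D: "((\<lambda>r. cutoff x y n r * \<phi> r) has_real_derivative
        cutoff_deriv x y n r * \<phi> r + cutoff x y n r * \<phi>' r) (at r)" for r
      using DERIV_mult[OF cutoff_has_derivative \<phi>] by (simp add: mult.commute add.commute)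
    then show "deriv (\<lambda>r. cutoff x y n r * \<phi> r) r = cutoff_deriv x y n r * \<phi> r + cutoff x y n r * \<phi>' r"
      by (rule DERIV_imp_deriv)
    have "continuous_on UNIV (cutoff x y n)"
      using cutoff_has_derivative by (meson DERIV_continuous_on has_field_derivative_at_within)
    then have "continuous_on UNIV (\<lambda>r. cutoff_deriv x y n r * \<phi> r + cutoff x y n r * \<phi>' r)"
      unfolding cutoff_deriv_def by (intro continuous_intros cont_\<phi> cont_\<phi>')
    then have C1: "(\<lambda>r. cutoff x y n r * \<phi> r) C1_differentiable_on UNIV"
      unfolding C1_differentiable_on_def
      by (intro exI[of _ "\<lambda>r. cutoff_deriv x y n r * \<phi> r + cutoff x y n r * \<phi>' r"] conjI ballI
          D[unfolded has_real_derivative_iff_has_vector_derivative])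
    have n0: "1 / real n > 0"
      using n by (cases n) auto
    have sub: "closure {r. cutoff x y n r * \<phi> r \<noteq> 0} \<subseteq> {x + 1 / real n..y - 1 / real n}"
      using cutoff_eq_0[OF less_imp_le[OF xy(2)] n]
      by (intro closure_minimal closed_atLeastAtMost) force
    have "{x + 1 / real n..y - 1 / real n} \<subseteq> {a<..<b}"
    proof
      fix r assume "r \<in> {x + 1 / real n..y - 1 / real n}"
      then show "r \<in> {a<..<b}"
        using n0 xy unfolding atLeastAtMost_iff greaterThanLessThan_iff by linarith
    qed
    moreover have "compact (closure {r. cutoff x y n r * \<phi> r \<noteq> 0})"
      using compact_Int_closed[OF compact_Icc closed_closure] sub by (metis Int_absorb1)
    ultimately show "test_fun a b (\<lambda>r. cutoff x y n r * \<phi> r)"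
      using C1 sub by (auto simp: test_fun_def)
  qed
  have identity: "(LINT r:{a<..<b}|lebesgue. cutoff_deriv x y n r *\<^sub>R (\<phi> r *\<^sub>R v r))
      + (LINT r:{a<..<b}|lebesgue. cutoff x y n r *\<^sub>R (\<phi>' r *\<^sub>R v r))
      = - (LINT r:{a<..<b}|lebesgue. cutoff x y n r *\<^sub>R (\<phi> r *\<^sub>R g r))"
    if n: "3 < real n * (y - x)" for n
  proof -
    have "set_integrable lebesgue {a<..<b} (\<lambda>r. cutoff_deriv x y n r *\<^sub>R (\<phi> r *\<^sub>R v r))"
      unfolding cutoff_deriv_def
      by (rule set_integrable_subset[of _ "{a..b}"])
         (auto intro!: absolutely_integrable_continuous_real continuous_intros v cont_\<phi>)
    then have "(LINT r:{a<..<b}|lebesgue. cutoff_deriv x y n r *\<^sub>R (\<phi> r *\<^sub>R v r))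
      + (LINT r:{a<..<b}|lebesgue. cutoff x y n r *\<^sub>R (\<phi>' r *\<^sub>R v r))
      = (LINT r:{a<..<b}|lebesgue. deriv (\<lambda>r. cutoff x y n r * \<phi> r) r *\<^sub>R v r)"
      by (subst set_integral_add(2)[symmetric])
         (simp_all add: integral_cutoff_tendsto(2)[OF int_v xy, simplified] deriv[OF n] scaleR_add_left)
    also have "\<dots> = - (LINT r:{a<..<b}|lebesgue. (cutoff x y n r * \<phi> r) *\<^sub>R g r)"
      using g test[OF n] unfolding is_weak_deriv_def by blast
    finally show ?thesis by simp
  qed
  have "(\<lambda>n. (LINT r:{a<..<b}|lebesgue. cutoff_deriv x y n r *\<^sub>R (\<phi> r *\<^sub>R v r))
      + (LINT r:{a<..<b}|lebesgue. cutoff x y n r *\<^sub>R (\<phi>' r *\<^sub>R v r)))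
      \<longlonglongrightarrow> (\<phi> x *\<^sub>R v x - \<phi> y *\<^sub>R v y) + (LINT r:{x<..<y}|lebesgue. \<phi>' r *\<^sub>R v r)"
    by (intro tendsto_add integral_cutoff_tendsto[OF int_v xy]
          integral_cutoff_deriv_tendsto[OF _ xy] continuous_intros cont_\<phi> v)
  moreover have "\<forall>\<^sub>F n in sequentially. 3 < real n * (y - x)"
    using xy by (intro eventually_real_mult_gt) simp
  then have "\<forall>\<^sub>F n in sequentially. (LINT r:{a<..<b}|lebesgue. cutoff_deriv x y n r *\<^sub>R (\<phi> r *\<^sub>R v r))
      + (LINT r:{a<..<b}|lebesgue. cutoff x y n r *\<^sub>R (\<phi>' r *\<^sub>R v r))
      = - (LINT r:{a<..<b}|lebesgue. cutoff x y n r *\<^sub>R (\<phi> r *\<^sub>R g r))"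
    by eventually_elim (rule identity)
  ultimately have "(\<lambda>n. - (LINT r:{a<..<b}|lebesgue. cutoff x y n r *\<^sub>R (\<phi> r *\<^sub>R g r)))
      \<longlonglongrightarrow> (\<phi> x *\<^sub>R v x - \<phi> y *\<^sub>R v y) + (LINT r:{x<..<y}|lebesgue. \<phi>' r *\<^sub>R v r)"
    by (rule Lim_transform_eventually)
  moreover have "(\<lambda>n. - (LINT r:{a<..<b}|lebesgue. cutoff x y n r *\<^sub>R (\<phi> r *\<^sub>R g r)))
      \<longlonglongrightarrow> - (LINT r:{x<..<y}|lebesgue. \<phi> r *\<^sub>R g r)"
    by (intro tendsto_minus integral_cutoff_tendsto(1)[OF int_g xy])
  ultimately have "(\<phi> x *\<^sub>R v x - \<phi> y *\<^sub>R v y) + (LINT r:{x<..<y}|lebesgue. \<phi>' r *\<^sub>R v r)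
      = - (LINT r:{x<..<y}|lebesgue. \<phi> r *\<^sub>R g r)"
    by (rule LIMSEQ_unique)
  then show ?thesis
    by (simp add: algebra_simps)
qed

section \<open>Uniqueness of weak derivatives\<close>

text \<open>Half-open intervals are stable under intersection and generate the Borel sets. The sets over which
  \<open>h\<close> integrates to zero are closed under disjoint unions, and under complements because the total
  integral is zero.\<close>
lemma integral_eq_0_borel_if_intervals:
  fixes h :: "real \<Rightarrow> 'b::euclidean_space"
  assumes h: "integrable lebesgue h" "(LINT r|lebesgue. h r) = 0"
    and zero: "\<And>x y. x < y \<Longrightarrow> (LINT r:{x<..y}|lebesgue. h r) = 0"
    and A: "A \<in> sets borel"
  shows "(LINT r:A|lebesgue. h r) = 0"
proof -
  have stable: "Int_stable (range (\<lambda>(x, y). {x<..y::real}))"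
  proof (rule Int_stableI)
    fix A B :: "real set"
    assume "A \<in> range (\<lambda>(x, y). {x<..y})" "B \<in> range (\<lambda>(x, y). {x<..y})"
    then obtain x y x' y' where "A = {x<..y}" "B = {x'<..y'}" by auto
    then have "A \<inter> B = {max x x'<..min y y'}" by auto
    then show "A \<inter> B \<in> range (\<lambda>(x, y). {x<..y})" by auto
  qed
  have A': "A \<in> sigma_sets UNIV (range (\<lambda>(x, y). {x<..y::real}))"
    using A by (simp add: borel_sigma_sets_Ioc)
  have int: "set_integrable lebesgue S h" if "S \<in> sets borel" for S
    using that h(1) unfolding set_integrable_def by (intro integrable_mult_indicator) auto
  have "range (\<lambda>(x, y). {x<..y::real}) \<subseteq> Pow UNIV" by simp
  from stable this A' show ?thesis
  proof (induction rule: sigma_sets_induct_disjoint)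
    case (basic A)
    then obtain x y where "A = {x<..y}" by auto
    then show ?case using zero[of x y] by (cases "x < y") (auto simp: set_lebesgue_integral_def)
  next
    case empty
    show ?case by (simp add: set_lebesgue_integral_def)
  next
    case (compl A)
    have A: "A \<in> sets borel"
      using compl by (simp add: borel_sigma_sets_Ioc)
    have "(LINT r:A \<union> (UNIV - A)|lebesgue. h r)
        = (LINT r:A|lebesgue. h r) + (LINT r:UNIV - A|lebesgue. h r)"
      using A by (intro set_integral_Un int) auto
    moreover have "A \<union> (UNIV - A) = UNIV" by auto
    ultimately show ?case
      using compl h(2) by (simp add: set_lebesgue_integral_def)
  next
    case (union A)
    have A: "A i \<in> sets borel" for i
      using union(2) by (auto simp: borel_sigma_sets_Ioc)
    have "(LINT r:(\<Union>i. A i)|lebesgue. h r) = (\<Sum>i. LINT r:A i|lebesgue. h r)"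
      using union(1) A
      by (intro lebesgue_integral_countable_add int)
         (auto simp: disjoint_family_on_def)
    then show ?case
      using union(3) by simp
  qed
qed

text \<open>Every Lebesgue set is Borel up to a null set, so \<open>h\<close> integrates to zero over all Lebesgue sets.\<close>
lemma AE_eq_0_if_interval_integrals_eq_0:
  fixes h :: "real \<Rightarrow> 'b::euclidean_space"
  assumes h: "integrable lebesgue h" "(LINT r|lebesgue. h r) = 0"
    and zero: "\<And>x y. x < y \<Longrightarrow> (LINT r:{x<..y}|lebesgue. h r) = 0"
  shows "AE r in lebesgue. h r = 0"
proof (rule sigma_finite_measure.density_zero[OF _ h(1)])
  show "sigma_finite_measure (lebesgue :: real measure)"
  proof
    have "\<exists>n. r \<in> {- real n..real n}" for r :: real
      using real_arch_simple[of "\<bar>r\<bar>"] by (auto simp: abs_le_iff minus_le_iff)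
    then have "(\<Union>n. {- real n..real n}) = UNIV" by blast
    then show "\<exists>A. countable A \<and> A \<subseteq> sets lebesgue \<and> \<Union> A = space (lebesgue :: real measure) \<and>
        (\<forall>a\<in>A. emeasure lebesgue a \<noteq> \<infinity>)"
      by (intro exI[of _ "range (\<lambda>n. {- real n..real n})"]) auto
  qed
  fix A :: "real set" assume A: "A \<in> sets lebesgue"
  from A obtain S N N' where S: "A = S \<union> N" "N \<subseteq> N'" "N' \<in> null_sets lborel" "S \<in> sets lborel"
    by (rule sets_completionE)
  have "(LINT r:A|lebesgue. h r) = (LINT r:S|lebesgue. h r)"
  proof (rule set_integral_cong_set)
    have "AE r in lebesgue. r \<notin> N'"
      using S(3) by (intro AE_not_in) (simp add: null_sets_completionI)
    then show "AE r in lebesgue. (r \<in> S) = (r \<in> A)"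
      by eventually_elim (use S in auto)
    show "set_borel_measurable lebesgue A h" "set_borel_measurable lebesgue S h"
      using A S(4) unfolding set_borel_measurable_def
      by (auto intro!: borel_measurable_integrable integrable_mult_indicator h(1))
  qed
  also have "\<dots> = 0"
    using S(4) by (intro integral_eq_0_borel_if_intervals[OF h zero]) auto
  finally show "(LINT r:A|lebesgue. h r) = 0" .
qed

lemma integral_weak_deriv:
  assumes "is_weak_deriv a b v g" "continuous_on {a..b} v" "a \<le> x" "x < y" "y \<le> b"
  shows "(LINT r:{x<..<y}|lebesgue. g r) = v y - v x"
  using weak_integration_by_parts[OF assms, of "\<lambda>_. 1" "\<lambda>_. 0"] by simp

text \<open>Weak derivatives of a continuous function have the same integrals over all intervals, namely its
  increments.\<close>
lemma weak_deriv_unique: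
  fixes v :: "real \<Rightarrow> real ^ 'n"
  assumes g: "is_weak_deriv a b v g" "is_weak_deriv a b v g'"
    and v: "continuous_on {a..b} v" and ab: "a < b"
  shows "AE r in lebesgue. r \<in> {a<..<b} \<longrightarrow> g r = g' r"
proof -
  let ?h = "\<lambda>r. indicator {a<..<b} r *\<^sub>R (g r - g' r)"
  have int: "set_integrable lebesgue {a<..<b} g" "set_integrable lebesgue {a<..<b} g'"
    using g by (auto simp: is_weak_deriv_def)
  have sub: "(LINT r:{x<..<y}|lebesgue. g r - g' r) = 0" if "a \<le> x" "x < y" "y \<le> b" for x y
  proof -
    have "set_integrable lebesgue {x<..<y} g" "set_integrable lebesgue {x<..<y} g'"
      using that int by (auto intro: set_integrable_subset)
    then show ?thesis
      using integral_weak_deriv[OF g(1) v that] integral_weak_deriv[OF g(2) v that]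
      by (simp add: set_integral_diff)
  qed
  have "AE r in lebesgue. ?h r = 0"
  proof (rule AE_eq_0_if_interval_integrals_eq_0)
    show int_h: "integrable lebesgue ?h"
      using set_integral_diff(1)[OF int] by (simp add: set_integrable_def)
    show "(LINT r|lebesgue. ?h r) = 0"
      using sub[of a b] ab by (simp add: set_lebesgue_integral_def)
    fix x y :: real assume "x < y"
    let ?x = "max a x" and ?y = "min b y"
    have "(LINT r:{x<..y}|lebesgue. ?h r) = (LINT r:{?x<..<?y}|lebesgue. g r - g' r)"
      unfolding set_lebesgue_integral_def
    proof (rule integral_cong_AE)
      have "AE r in lebesgue. r \<noteq> y"
        by (intro AE_not_in[of "{y}", simplified]) simp
      then show "AE r in lebesgue. indicat_real {x<..y} r *\<^sub>R ?h r
          = indicat_real {?x<..<?y} r *\<^sub>R (g r - g' r)"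
        by eventually_elim (auto simp: indicator_def)
      show "(\<lambda>r. indicat_real {x<..y} r *\<^sub>R ?h r) \<in> borel_measurable lebesgue"
        by (intro borel_measurable_integrable integrable_mult_indicator int_h) simp
      have eq: "indicat_real {?x<..<?y} r *\<^sub>R (g r - g' r) = indicat_real {?x<..<?y} r *\<^sub>R ?h r" for r
        by (auto simp: indicator_def)
      show "(\<lambda>r. indicat_real {?x<..<?y} r *\<^sub>R (g r - g' r)) \<in> borel_measurable lebesgue"
        unfolding eq by (intro borel_measurable_integrable integrable_mult_indicator int_h) simp
    qed
    also have "\<dots> = 0"
      using sub[of ?x ?y] by (cases "?x < ?y") (auto simp: set_lebesgue_integral_def)
    finally show "(LINT r:{x<..y}|lebesgue. ?h r) = 0" .
  qed
  then show ?thesis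
    by eventually_elim (auto simp: indicator_def)
qed

section \<open>Absolutely continuous functions\<close>

text \<open>The following two rules state absolute continuity with projections in place of pattern matching,
  and with one premise for each condition on the family of intervals.\<close>
lemma abs_cont_onE:
  assumes "abs_cont_on a b u" "0 < \<epsilon>"
  obtains \<delta> where "0 < \<delta>"
    "\<And>I. finite I \<Longrightarrow> (\<And>z. z \<in> I \<Longrightarrow> a \<le> fst z \<and> fst z \<le> snd z \<and> snd z \<le> b) \<Longrightarrow>
      disjoint_family_on (\<lambda>z. {fst z<..<snd z}) I \<Longrightarrow> (\<Sum>z\<in>I. snd z - fst z) < \<delta> \<Longrightarrow>
      (\<Sum>z\<in>I. norm (u (snd z) - u (fst z))) < \<epsilon>"
proof -
  from assms obtain \<delta> where \<delta>: "0 < \<delta>"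
    "\<forall>I. finite I \<and> (\<forall>z\<in>I. a \<le> fst z \<and> fst z \<le> snd z \<and> snd z \<le> b) \<and>
      disjoint_family_on (\<lambda>z. {fst z<..<snd z}) I \<and> (\<Sum>z\<in>I. snd z - fst z) < \<delta> \<longrightarrow>
      (\<Sum>z\<in>I. norm (u (snd z) - u (fst z))) < \<epsilon>"
    unfolding abs_cont_on_def case_prod_unfold by blast
  show thesis
    by (rule that[OF \<delta>(1)]) (use \<delta>(2) in simp)
qed

lemma abs_cont_onI:
  assumes "\<And>\<epsilon>. 0 < \<epsilon> \<Longrightarrow> \<exists>\<delta>>0. \<forall>I. finite I \<longrightarrow> (\<forall>z\<in>I. a \<le> fst z \<and> fst z \<le> snd z \<and> snd z \<le> b) \<longrightarrow>
      disjoint_family_on (\<lambda>z. {fst z<..<snd z}) I \<longrightarrow> (\<Sum>z\<in>I. snd z - fst z) < \<delta> \<longrightarrow>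
      (\<Sum>z\<in>I. norm (u (snd z) - u (fst z))) < \<epsilon>"
  shows "abs_cont_on a b u"
  unfolding abs_cont_on_def case_prod_unfold imp_conjL by (intro allI impI assms[rule_format])

lemma abs_cont_on_imp_continuous_on:
  assumes u: "abs_cont_on a b u"
  shows "continuous_on {a..b} u"
  unfolding continuous_on_iff
proof (intro ballI allI impI)
  fix x \<epsilon> :: real assume x: "x \<in> {a..b}" and \<epsilon>: "0 < \<epsilon>"
  from u \<epsilon> obtain \<delta> where \<delta>: "\<delta> > 0" and *: "\<And>I. finite I \<Longrightarrow>
      (\<And>z. z \<in> I \<Longrightarrow> a \<le> fst z \<and> fst z \<le> snd z \<and> snd z \<le> b) \<Longrightarrow>
      disjoint_family_on (\<lambda>z. {fst z<..<snd z}) I \<Longrightarrow> (\<Sum>z\<in>I. snd z - fst z) < \<delta> \<Longrightarrow>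
      (\<Sum>z\<in>I. norm (u (snd z) - u (fst z))) < \<epsilon>"
    by (rule abs_cont_onE) blast
  have small: "norm (u y - u x) < \<epsilon>" if "a \<le> x" "x \<le> y" "y \<le> b" "y - x < \<delta>" for x y
    using *[of "{(x, y)}"] that by (simp add: disjoint_family_on_def)
  show "\<exists>d>0. \<forall>x'\<in>{a..b}. dist x' x < d \<longrightarrow> dist (u x') (u x) < \<epsilon>"
  proof (intro exI conjI ballI impI)
    fix x' assume x': "x' \<in> {a..b}" "dist x' x < \<delta>"
    then show "dist (u x') (u x) < \<epsilon>"
      using small[of x x'] small[of x' x] x
      by (cases "x \<le> x'") (auto simp: dist_norm norm_minus_commute)
  qed (rule \<delta>)
qed

lemma abs_cont_on_add:
  assumes u: "abs_cont_on a b u" and w: "abs_cont_on a b w"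
  shows "abs_cont_on a b (\<lambda>r. u r + w r)"
proof (rule abs_cont_onI)
  fix \<epsilon> :: real assume "0 < \<epsilon>"
  then have half: "0 < \<epsilon> / 2" by simp
  from u half obtain \<delta> where \<delta>: "\<delta> > 0" and *: "\<And>I. finite I \<Longrightarrow>
      (\<And>z. z \<in> I \<Longrightarrow> a \<le> fst z \<and> fst z \<le> snd z \<and> snd z \<le> b) \<Longrightarrow>
      disjoint_family_on (\<lambda>z. {fst z<..<snd z}) I \<Longrightarrow> (\<Sum>z\<in>I. snd z - fst z) < \<delta> \<Longrightarrow>
      (\<Sum>z\<in>I. norm (u (snd z) - u (fst z))) < \<epsilon> / 2"
    by (rule abs_cont_onE) blast
  from w half obtain \<eta> where \<eta>: "\<eta> > 0" and **: "\<And>I. finite I \<Longrightarrow>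
      (\<And>z. z \<in> I \<Longrightarrow> a \<le> fst z \<and> fst z \<le> snd z \<and> snd z \<le> b) \<Longrightarrow>
      disjoint_family_on (\<lambda>z. {fst z<..<snd z}) I \<Longrightarrow> (\<Sum>z\<in>I. snd z - fst z) < \<eta> \<Longrightarrow>
      (\<Sum>z\<in>I. norm (w (snd z) - w (fst z))) < \<epsilon> / 2"
    by (rule abs_cont_onE) blast
  show "\<exists>\<delta>>0. \<forall>I. finite I \<longrightarrow> (\<forall>z\<in>I. a \<le> fst z \<and> fst z \<le> snd z \<and> snd z \<le> b) \<longrightarrow>
      disjoint_family_on (\<lambda>z. {fst z<..<snd z}) I \<longrightarrow> (\<Sum>z\<in>I. snd z - fst z) < \<delta> \<longrightarrow>
      (\<Sum>z\<in>I. norm (u (snd z) + w (snd z) - (u (fst z) + w (fst z)))) < \<epsilon>"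
  proof (intro exI conjI allI impI)
    show "0 < min \<delta> \<eta>" using \<delta> \<eta> by simp
    fix I :: "(real \<times> real) set"
    assume I: "finite I" "\<forall>z\<in>I. a \<le> fst z \<and> fst z \<le> snd z \<and> snd z \<le> b"
      "disjoint_family_on (\<lambda>z. {fst z<..<snd z}) I" "(\<Sum>z\<in>I. snd z - fst z) < min \<delta> \<eta>"
    have "(\<Sum>z\<in>I. norm (u (snd z) + w (snd z) - (u (fst z) + w (fst z))))
        \<le> (\<Sum>z\<in>I. norm (u (snd z) - u (fst z)) + norm (w (snd z) - w (fst z)))"
      unfolding add_diff_add by (intro sum_mono norm_triangle_ineq)
    also have "\<dots> = (\<Sum>z\<in>I. norm (u (snd z) - u (fst z))) + (\<Sum>z\<in>I. norm (w (snd z) - w (fst z)))"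
      by (rule sum.distrib)
    also have "\<dots> < \<epsilon> / 2 + \<epsilon> / 2"
      using I by (intro add_strict_mono * **) auto
    finally show "(\<Sum>z\<in>I. norm (u (snd z) + w (snd z) - (u (fst z) + w (fst z)))) < \<epsilon>" by simp
  qed
qed

lemma abs_cont_on_minus: "abs_cont_on a b u \<Longrightarrow> abs_cont_on a b (\<lambda>r. - u r)"
  unfolding abs_cont_on_def by (simp add: norm_minus_commute)

lemma lipschitz_imp_abs_cont_on:
  assumes lip: "\<And>x y. x \<le> y \<Longrightarrow> norm (u y - u x) \<le> C * (y - x)"
  shows "abs_cont_on a b u"
proof (rule abs_cont_onI)
  fix \<epsilon> :: real assume \<epsilon>: "0 < \<epsilon>"
  define D where "D = max 1 C"
  have D: "D > 0" by (simp add: D_def)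
  show "\<exists>\<delta>>0. \<forall>I. finite I \<longrightarrow> (\<forall>z\<in>I. a \<le> fst z \<and> fst z \<le> snd z \<and> snd z \<le> b) \<longrightarrow>
      disjoint_family_on (\<lambda>z. {fst z<..<snd z}) I \<longrightarrow> (\<Sum>z\<in>I. snd z - fst z) < \<delta> \<longrightarrow>
      (\<Sum>z\<in>I. norm (u (snd z) - u (fst z))) < \<epsilon>"
  proof (intro exI conjI allI impI)
    show "0 < \<epsilon> / D" using \<epsilon> D by simp
    fix I :: "(real \<times> real) set"
    assume I: "\<forall>z\<in>I. a \<le> fst z \<and> fst z \<le> snd z \<and> snd z \<le> b" "(\<Sum>z\<in>I. snd z - fst z) < \<epsilon> / D"
    have "norm (u (snd z) - u (fst z)) \<le> D * (snd z - fst z)" if "z \<in> I" for z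
      using lip[of "fst z" "snd z"] mult_right_mono[of C D "snd z - fst z"] I(1) that
      by (force simp: D_def)
    then have "(\<Sum>z\<in>I. norm (u (snd z) - u (fst z))) \<le> (\<Sum>z\<in>I. D * (snd z - fst z))"
      by (rule sum_mono)
    also have "\<dots> = D * (\<Sum>z\<in>I. snd z - fst z)"
      by (rule sum_distrib_left[symmetric])
    also have "\<dots> < \<epsilon>"
      using I(2) D by (simp add: pos_less_divide_eq mult.commute)
    finally show "(\<Sum>z\<in>I. norm (u (snd z) - u (fst z))) < \<epsilon>" .
  qed
qed

text \<open>Clamping shortens intervals and keeps them disjoint. Intervals that it collapses contribute nothing
  and have to be removed first: several of them may have the same image, whereas clamping is
  injective on the others.\<close>
lemma abs_cont_on_clamp:
  assumes u: "abs_cont_on a b u" and xy: "a \<le> x" "x \<le> y" "y \<le> b"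
  shows "abs_cont_on a b (\<lambda>r. u (max x (min y r)))"
proof (rule abs_cont_onI)
  fix \<epsilon> :: real assume "0 < \<epsilon>"
  with u obtain \<delta> where \<delta>: "\<delta> > 0" and *: "\<And>I. finite I \<Longrightarrow>
      (\<And>z. z \<in> I \<Longrightarrow> a \<le> fst z \<and> fst z \<le> snd z \<and> snd z \<le> b) \<Longrightarrow>
      disjoint_family_on (\<lambda>z. {fst z<..<snd z}) I \<Longrightarrow> (\<Sum>z\<in>I. snd z - fst z) < \<delta> \<Longrightarrow>
      (\<Sum>z\<in>I. norm (u (snd z) - u (fst z))) < \<epsilon>"
    by (rule abs_cont_onE) blast
  define c where "c r = max x (min y r)" for r
  have c_mono: "c p \<le> c q" and c_lip: "c q - c p \<le> q - p" if "p \<le> q" for p q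
    using that xy by (auto simp: c_def max_def min_def)
  have c_range: "a \<le> c p" "c p \<le> b" for p
    using xy by (auto simp: c_def)
  have c_between: "p < m" "m < q" if "c p < m" "m < c q" for p q m
    using that xy by (auto simp: c_def max_def min_def split: if_splits)
  show "\<exists>\<delta>>0. \<forall>I. finite I \<longrightarrow> (\<forall>z\<in>I. a \<le> fst z \<and> fst z \<le> snd z \<and> snd z \<le> b) \<longrightarrow>
      disjoint_family_on (\<lambda>z. {fst z<..<snd z}) I \<longrightarrow> (\<Sum>z\<in>I. snd z - fst z) < \<delta> \<longrightarrow>
      (\<Sum>z\<in>I. norm (u (max x (min y (snd z))) - u (max x (min y (fst z))))) < \<epsilon>"
    unfolding c_def[symmetric]
  proof (intro exI conjI allI impI)
    show "0 < \<delta>" by (rule \<delta>)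
    fix I :: "(real \<times> real) set"
    assume I: "finite I" "\<forall>z\<in>I. a \<le> fst z \<and> fst z \<le> snd z \<and> snd z \<le> b"
      "disjoint_family_on (\<lambda>z. {fst z<..<snd z}) I" "(\<Sum>z\<in>I. snd z - fst z) < \<delta>"
    define J where "J = {z \<in> I. c (fst z) < c (snd z)}"
    define f where "f z = (c (fst z), c (snd z))" for z
    have f [simp]: "fst (f z) = c (fst z)" "snd (f z) = c (snd z)" for z
      by (simp_all add: f_def)
    have JI: "finite J" "J \<subseteq> I" using I(1) by (auto simp: J_def)
    have disj: "z = z'"
      if "z \<in> J" "z' \<in> J" "c (fst z) < m" "m < c (snd z)" "c (fst z') < m" "m < c (snd z')"
      for z z' m
    proof (rule ccontr)
      assume "z \<noteq> z'"
      then have "{fst z<..<snd z} \<inter> {fst z'<..<snd z'} = {}"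
        using I(3) that(1,2) JI(2) unfolding disjoint_family_on_def by blast
      moreover have "m \<in> {fst z<..<snd z}" "m \<in> {fst z'<..<snd z'}"
        using c_between[OF that(3,4)] c_between[OF that(5,6)] by auto
      ultimately show False by blast
    qed
    have inj: "inj_on f J"
    proof (rule inj_onI)
      fix z z' assume z: "z \<in> J" "z' \<in> J" and eq: "f z = f z'"
      have "c (fst z) < c (snd z)" using z by (simp add: J_def)
      then obtain m where "c (fst z) < m" "m < c (snd z)"
        using dense by blast
      with eq show "z = z'" using disj[OF z] by (simp add: f_def)
    qed
    have "(\<Sum>z\<in>I. norm (u (c (snd z)) - u (c (fst z)))) = (\<Sum>z\<in>J. norm (u (c (snd z)) - u (c (fst z))))"
    proof (rule sum.mono_neutral_right[OF I(1) JI(2)])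
      show "\<forall>z\<in>I - J. norm (u (c (snd z)) - u (c (fst z))) = 0"
      proof
        fix z assume z: "z \<in> I - J"
        then have "c (fst z) = c (snd z)"
          using I(2) c_mono[of "fst z" "snd z"] by (force simp: J_def)
        then show "norm (u (c (snd z)) - u (c (fst z))) = 0" by simp
      qed
    qed
    also have "\<dots> = (\<Sum>z\<in>f ` J. norm (u (snd z) - u (fst z)))"
      by (subst sum.reindex[OF inj]) simp
    also have "\<dots> < \<epsilon>"
    proof (rule *)
      show "finite (f ` J)" using JI by simp
      show "a \<le> fst z \<and> fst z \<le> snd z \<and> snd z \<le> b" if "z \<in> f ` J" for z
        using that c_range by (auto simp: J_def)
      show "disjoint_family_on (\<lambda>z. {fst z<..<snd z}) (f ` J)"
        unfolding disjoint_family_on_def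
      proof (intro ballI impI)
        fix k l assume "k \<in> f ` J" "l \<in> f ` J" and kl: "k \<noteq> l"
        then obtain z z' where z: "z \<in> J" "z' \<in> J" "k = f z" "l = f z'" by blast
        show "{fst k<..<snd k} \<inter> {fst l<..<snd l} = {}"
          by (rule equals0I) (use disj[OF z(1,2)] kl z(3,4) in auto)
      qed
      have "(\<Sum>z\<in>f ` J. snd z - fst z) = (\<Sum>z\<in>J. c (snd z) - c (fst z))"
        by (subst sum.reindex[OF inj]) simp
      also have "\<dots> \<le> (\<Sum>z\<in>J. snd z - fst z)"
        using I(2) JI(2) by (intro sum_mono c_lip) auto
      also have "\<dots> \<le> (\<Sum>z\<in>I. snd z - fst z)"
        using I(2) by (intro sum_mono2[OF I(1) JI(2)]) auto
      finally show "(\<Sum>z\<in>f ` J. snd z - fst z) < \<delta>" using I(4) by linarith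
    qed
    finally show "(\<Sum>z\<in>I. norm (u (c (snd z)) - u (c (fst z)))) < \<epsilon>" .
  qed
qed

section \<open>Replacing a function by its chord on a subinterval\<close>

definition chord :: "(real \<Rightarrow> 'b::real_vector) \<Rightarrow> real \<Rightarrow> real \<Rightarrow> real \<Rightarrow> 'b" where
  "chord v x y r = v x + (r - x) *\<^sub>R ((v y - v x) /\<^sub>R (y - x))"

text \<open>The competitor against which a minimizer is tested: it follows the chord of \<open>v\<close> between \<open>x\<close> and \<open>y\<close>.\<close>
definition cut_corner :: "(real \<Rightarrow> 'b::real_vector) \<Rightarrow> real \<Rightarrow> real \<Rightarrow> real \<Rightarrow> 'b" where
  "cut_corner v x y r = (if r \<in> {x<..<y} then chord v x y r else v r)"

lemma chord_endpoints [simp]: "chord v x y x = v x" "x < y \<Longrightarrow> chord v x y y = v y"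
  by (simp_all add: chord_def)

lemma chord_norm_diff:
  "norm (chord v x y r - chord v x y s) = \<bar>r - s\<bar> * norm ((v y - v x) /\<^sub>R (y - x))"
  for v :: "real \<Rightarrow> 'b::real_normed_vector"
proof -
  have "chord v x y r - chord v x y s = (r - s) *\<^sub>R ((v y - v x) /\<^sub>R (y - x))"
    by (simp only: chord_def scaleR_diff_left) simp
  then show ?thesis by (simp only: norm_scaleR)
qed

lemma chord_in_convex:
  assumes "convex C" "v x \<in> C" "v y \<in> C" "x < y" "r \<in> {x..y}"
  shows "chord v x y r \<in> C"
proof -
  define s where "s = (r - x) / (y - x)"
  have "0 \<le> s" "s \<le> 1"
    using assms(4,5) by (auto simp: s_def divide_le_eq_1)
  then have "(1 - s) *\<^sub>R v x + s *\<^sub>R v y \<in> C"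
    by (rule convexD_alt[OF assms(1-3)])
  moreover have "chord v x y r = (1 - s) *\<^sub>R v x + s *\<^sub>R v y"
    by (simp add: chord_def s_def divide_inverse algebra_simps)
  ultimately show ?thesis by simp
qed

text \<open>The competitor is obtained from \<open>v\<close> by subtracting the clamped \<open>v\<close> and adding the clamped chord, and
  the clamped chord is Lipschitz.\<close>
lemma abs_cont_on_cut_corner:
  assumes v: "abs_cont_on a b v" and xy: "a \<le> x" "x < y" "y \<le> b"
  shows "abs_cont_on a b (cut_corner v x y)"
proof -
  let ?c = "\<lambda>r. max x (min y r)"
  have "norm (chord v x y (?c q) - chord v x y (?c p)) \<le> norm ((v y - v x) /\<^sub>R (y - x)) * (q - p)"
    if "p \<le> q" for p q
  proof -
    have "\<bar>?c q - ?c p\<bar> \<le> q - p" using that by (auto simp: max_def min_def)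
    then have "\<bar>?c q - ?c p\<bar> * norm ((v y - v x) /\<^sub>R (y - x))
        \<le> (q - p) * norm ((v y - v x) /\<^sub>R (y - x))"
      by (rule mult_right_mono) simp
    then show ?thesis
      by (simp only: chord_norm_diff mult.commute)
  qed
  then have chord_ac: "abs_cont_on a b (\<lambda>r. chord v x y (?c r))"
    by (rule lipschitz_imp_abs_cont_on)
  have "abs_cont_on a b (\<lambda>r. v (?c r))"
    using xy by (intro abs_cont_on_clamp v) auto
  then have "abs_cont_on a b (\<lambda>r. (v r + - v (?c r)) + chord v x y (?c r))"
    by (intro abs_cont_on_add abs_cont_on_minus v chord_ac)
  also have "(\<lambda>r. (v r + - v (?c r)) + chord v x y (?c r)) = cut_corner v x y"
    using xy by (auto simp: fun_eq_iff cut_corner_def max_def min_def)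
  finally show ?thesis .
qed

lemma set_integral_override_subinterval:
  fixes f f' :: "real \<Rightarrow> 'b::euclidean_space"
  assumes sub: "{x<..<y} \<subseteq> {a<..<b}"
    and f: "set_integrable lebesgue {a<..<b} f" "set_integrable lebesgue {x<..<y} f'"
  shows "set_integrable lebesgue {a<..<b} (\<lambda>r. if r \<in> {x<..<y} then f' r else f r)"
    and "(LINT r:{a<..<b}|lebesgue. if r \<in> {x<..<y} then f' r else f r)
      = (LINT r:{a<..<b}|lebesgue. f r) + (LINT r:{x<..<y}|lebesgue. f' r) - (LINT r:{x<..<y}|lebesgue. f r)"
proof -
  have f_sub: "set_integrable lebesgue {x<..<y} f"
    by (rule set_integrable_subset[OF f(1) _ sub]) simp
  have eq: "indicator {a<..<b} r *\<^sub>R (if r \<in> {x<..<y} then f' r else f r)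
     = indicator {a<..<b} r *\<^sub>R f r + (indicator {x<..<y} r *\<^sub>R f' r - indicator {x<..<y} r *\<^sub>R f r)" for r
    using sub by (auto simp: indicator_def)
  show "set_integrable lebesgue {a<..<b} (\<lambda>r. if r \<in> {x<..<y} then f' r else f r)"
    using f f_sub unfolding set_integrable_def eq by auto
  show "(LINT r:{a<..<b}|lebesgue. if r \<in> {x<..<y} then f' r else f r)
    = (LINT r:{a<..<b}|lebesgue. f r) + (LINT r:{x<..<y}|lebesgue. f' r) - (LINT r:{x<..<y}|lebesgue. f r)"
    using f f_sub unfolding set_integrable_def set_lebesgue_integral_def eq by simp
qed

text \<open>On the modified interval both \<open>v\<close> and the chord can be integrated by parts against a test
  function. Their boundary terms agree, since the chord has the same end points as \<open>v\<close>.\<close>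
lemma is_weak_deriv_cut_corner:
  fixes v :: "real \<Rightarrow> real ^ 'n"
  assumes g: "is_weak_deriv a b v g" and v: "continuous_on {a..b} v"
    and xy: "a \<le> x" "x < y" "y \<le> b"
  shows "is_weak_deriv a b (cut_corner v x y)
           (\<lambda>r. if r \<in> {x<..<y} then (v y - v x) /\<^sub>R (y - x) else g r)"
    (is "is_weak_deriv a b ?w ?g")
proof -
  define q where "q = (v y - v x) /\<^sub>R (y - x)"
  have sub: "{x<..<y} \<subseteq> {a<..<b}" using xy by auto
  have g_int: "set_integrable lebesgue {a<..<b} g"
    using g by (simp add: is_weak_deriv_def)
  have const_int: "set_integrable lebesgue {x<..<y} f'" if "continuous_on UNIV f'" for f' :: "real \<Rightarrow> real ^ 'n"
    by (rule set_integrable_subset[of _ "{x..y}"])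
       (auto intro!: absolutely_integrable_continuous_real intro: continuous_on_subset[OF that])
  show ?thesis
    unfolding is_weak_deriv_def q_def[symmetric]
  proof (intro conjI allI impI)
    show "set_integrable lebesgue {a<..<b} (\<lambda>r. if r \<in> {x<..<y} then q else g r)"
      by (intro set_integral_override_subinterval(1)[OF sub] g_int const_int continuous_intros)
    fix \<phi> assume \<phi>: "test_fun a b \<phi>"
    then obtain D where D: "\<And>r. (\<phi> has_real_derivative D r) (at r)" and D_cont: "continuous_on UNIV D"
      unfolding test_fun_def C1_differentiable_on_def has_real_derivative_iff_has_vector_derivative
      by blast
    have deriv: "deriv \<phi> = D"
      using D by (auto intro: DERIV_imp_deriv)
    have cont: "continuous_on S \<phi>" "continuous_on S D" for S
      using D D_cont by (meson DERIV_continuous_on has_field_derivative_at_within continuous_on_subset subset_UNIV)+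
    have int_v: "set_integrable lebesgue {a<..<b} (\<lambda>r. D r *\<^sub>R v r)"
      by (rule set_integrable_subset[of _ "{a..b}"])
         (auto intro!: absolutely_integrable_continuous_real continuous_intros v cont)
    have cont_chord: "continuous_on UNIV (chord v x y)"
      unfolding chord_def by (intro continuous_intros)
    have int_g: "set_integrable lebesgue {a<..<b} (\<lambda>r. \<phi> r *\<^sub>R g r)"
      by (intro set_integrable_continuous_scaleR cont g_int)
    have chord_deriv: "(chord v x y has_vector_derivative q) (at r within S)" for r S
      unfolding chord_def q_def[symmetric]
      by (auto intro!: derivative_eq_intros)
    have "((\<lambda>r. \<phi> r *\<^sub>R q + D r *\<^sub>R chord v x y r) has_integral \<phi> y *\<^sub>R chord v x y y - \<phi> x *\<^sub>R chord v x y x) {x..y}"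
      using xy
      by (intro fundamental_theorem_of_calculus has_vector_derivative_scaleR chord_deriv
          has_field_derivative_at_within[OF D]) auto
    then have "(LINT r:{x<..<y}|lebesgue. \<phi> r *\<^sub>R q + D r *\<^sub>R chord v x y r) = \<phi> y *\<^sub>R v y - \<phi> x *\<^sub>R v x"
      using xy by (subst set_lebesgue_integral_eq_integral(2))
        (auto intro!: const_int continuous_intros cont cont_chord
          simp: integral_unique simp flip: integral_open_interval_real)
    moreover have "(LINT r:{x<..<y}|lebesgue. \<phi> r *\<^sub>R q + D r *\<^sub>R chord v x y r)
        = (LINT r:{x<..<y}|lebesgue. \<phi> r *\<^sub>R q) + (LINT r:{x<..<y}|lebesgue. D r *\<^sub>R chord v x y r)"
      by (intro set_integral_add const_int continuous_intros cont cont_chord)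
    ultimately have chord_parts: "(LINT r:{x<..<y}|lebesgue. \<phi> r *\<^sub>R q) + (LINT r:{x<..<y}|lebesgue. D r *\<^sub>R chord v x y r)
        = \<phi> y *\<^sub>R v y - \<phi> x *\<^sub>R v x" by simp
    have v_parts: "(LINT r:{x<..<y}|lebesgue. D r *\<^sub>R v r) = \<phi> y *\<^sub>R v y - \<phi> x *\<^sub>R v x
        - (LINT r:{x<..<y}|lebesgue. \<phi> r *\<^sub>R g r)"
      by (rule weak_integration_by_parts[OF g v xy D D_cont])
    have v_weak: "(LINT r:{a<..<b}|lebesgue. D r *\<^sub>R v r) = - (LINT r:{a<..<b}|lebesgue. \<phi> r *\<^sub>R g r)"
      using g \<phi> deriv unfolding is_weak_deriv_def by auto
    have "(LINT r:{a<..<b}|lebesgue. D r *\<^sub>R ?w r)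
        = (LINT r:{a<..<b}|lebesgue. if r \<in> {x<..<y} then D r *\<^sub>R chord v x y r else D r *\<^sub>R v r)"
      by (intro arg_cong[where f = "set_lebesgue_integral lebesgue {a<..<b}"]) (auto simp: cut_corner_def)
    also have "\<dots> = (LINT r:{a<..<b}|lebesgue. D r *\<^sub>R v r) + (LINT r:{x<..<y}|lebesgue. D r *\<^sub>R chord v x y r)
        - (LINT r:{x<..<y}|lebesgue. D r *\<^sub>R v r)"
      by (intro set_integral_override_subinterval(2)[OF sub] int_v const_int continuous_intros cont cont_chord)
    also have "\<dots> = - ((LINT r:{a<..<b}|lebesgue. \<phi> r *\<^sub>R g r) + (LINT r:{x<..<y}|lebesgue. \<phi> r *\<^sub>R q)
        - (LINT r:{x<..<y}|lebesgue. \<phi> r *\<^sub>R g r))"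
      unfolding v_weak v_parts using chord_parts by (simp add: algebra_simps)
    also have "(LINT r:{a<..<b}|lebesgue. \<phi> r *\<^sub>R g r) + (LINT r:{x<..<y}|lebesgue. \<phi> r *\<^sub>R q)
        - (LINT r:{x<..<y}|lebesgue. \<phi> r *\<^sub>R g r)
        = (LINT r:{a<..<b}|lebesgue. if r \<in> {x<..<y} then \<phi> r *\<^sub>R q else \<phi> r *\<^sub>R g r)"
      by (intro set_integral_override_subinterval(2)[OF sub, symmetric] int_g const_int continuous_intros cont)
    also have "\<dots> = (LINT r:{a<..<b}|lebesgue. \<phi> r *\<^sub>R (if r \<in> {x<..<y} then q else g r))"
      by (intro arg_cong[where f = "set_lebesgue_integral lebesgue {a<..<b}"]) auto
    finally show "(LINT r:{a<..<b}|lebesgue. deriv \<phi> r *\<^sub>R ?w r)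
        = - (LINT r:{a<..<b}|lebesgue. \<phi> r *\<^sub>R (if r \<in> {x<..<y} then q else g r))"
      by (simp add: deriv)
  qed
qed

section \<open>Convexity from subgradients\<close>

lemma subgradient_imp_convex_combination:
  assumes "is_subgradient f ((1 - \<theta>) *\<^sub>R p + \<theta> *\<^sub>R q) \<eta>" "0 \<le> \<theta>" "\<theta> \<le> 1"
  shows "f ((1 - \<theta>) *\<^sub>R p + \<theta> *\<^sub>R q) \<le> (1 - \<theta>) * f p + \<theta> * f q"
proof -
  let ?m = "(1 - \<theta>) *\<^sub>R p + \<theta> *\<^sub>R q"
  have "(1 - \<theta>) * (f ?m + \<eta> \<bullet> (p - ?m)) + \<theta> * (f ?m + \<eta> \<bullet> (q - ?m))
      \<le> (1 - \<theta>) * f p + \<theta> * f q"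
    using assms by (intro add_mono mult_left_mono) (auto simp: is_subgradient_def)
  moreover have "(1 - \<theta>) * (f ?m + \<eta> \<bullet> (p - ?m)) + \<theta> * (f ?m + \<eta> \<bullet> (q - ?m)) = f ?m"
    by (simp add: inner_simps algebra_simps)
  ultimately show ?thesis by simp
qed

text \<open>A convex function that exceeds an affine function touching it at \<open>p\<close> by \<open>\<kappa>\<close> on a sphere around \<open>p\<close>
  does so outside the ball as well, because along rays from \<open>p\<close> the excess grows at least linearly.
  The affine lower bound is asked for on the sphere, a compact set, so that it is stable under small
  perturbations of \<open>f\<close> and one vector \<open>\<xi>\<close> can serve at all nearby points in time and space.\<close>
lemma excess_outside_ball:
  assumes sub: "\<And>m. \<exists>\<eta>. is_subgradient f m \<eta>" and c: "0 < c" and \<kappa>: "0 \<le> \<kappa>"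
    and sphere: "\<And>m. norm (m - p) = c \<Longrightarrow> f p + \<xi> \<bullet> (m - p) + \<kappa> \<le> f m"
    and q: "c \<le> norm (q - p)"
  shows "f p + \<xi> \<bullet> (q - p) + \<kappa> \<le> f q"
proof -
  \<comment> \<open>The point \<open>m\<close> is where the segment from \<open>p\<close> to \<open>q\<close> crosses the sphere.\<close>
  define \<theta> where "\<theta> = c / norm (q - p)"
  have pos: "0 < norm (q - p)"
    using c q by linarith
  then have \<theta>: "0 < \<theta>" "\<theta> \<le> 1"
    using c q unfolding \<theta>_def by (simp_all only: divide_pos_pos divide_le_eq_1_pos)
  define m where "m = (1 - \<theta>) *\<^sub>R p + \<theta> *\<^sub>R q"
  have m: "m - p = \<theta> *\<^sub>R (q - p)"
    by (simp add: m_def algebra_simps)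
  have "norm (m - p) = c"
    unfolding m norm_scaleR using c pos by (simp only: \<theta>_def abs_divide abs_of_pos nonzero_eq_divide_eq) simp
  then have "f p + \<theta> * (\<xi> \<bullet> (q - p)) + \<kappa> \<le> f m"
    using sphere[of m] by (simp add: m)
  also have "f m \<le> (1 - \<theta>) * f p + \<theta> * f q"
    using sub[of m] \<theta> unfolding m_def by (auto intro: subgradient_imp_convex_combination)
  finally have "\<kappa> \<le> \<theta> * (f q - f p - \<xi> \<bullet> (q - p))"
    by (simp add: algebra_simps)
  moreover from this have "0 \<le> f q - f p - \<xi> \<bullet> (q - p)"
    using \<kappa> \<theta>(1) by (meson order_trans zero_le_mult_iff not_less)
  then have "\<theta> * (f q - f p - \<xi> \<bullet> (q - p)) \<le> f q - f p - \<xi> \<bullet> (q - p)"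
    using \<theta> by (simp add: mult_left_le_one_le)
  ultimately show ?thesis by linarith
qed

section \<open>Admissible competitors and their action\<close>

lemma weak_deriv_is_weak_deriv:
  assumes "u \<in> W11 a b"
  shows "is_weak_deriv a b u (weak_deriv a b u)"
proof -
  obtain g where "is_weak_deriv a b u g"
    using assms by (auto simp: W11_def)
  then show ?thesis
    unfolding weak_deriv_def by (rule someI[of "is_weak_deriv a b u"])
qed

lemma cut_corner_admissible:
  fixes v :: "real \<Rightarrow> real ^ 'n"
  assumes v: "v \<in> W11 a b" and xy: "a \<le> x" "x < y" "y \<le> b"
  shows "cut_corner v x y \<in> admissible a b (v a) (v b)"
    and "AE r in lebesgue. r \<in> {a<..<b} \<longrightarrow> weak_deriv a b (cut_corner v x y) r =
           (if r \<in> {x<..<y} then (v y - v x) /\<^sub>R (y - x) else weak_deriv a b v r)"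
proof -
  have ac: "abs_cont_on a b v"
    using v by (simp add: W11_def)
  have ac': "abs_cont_on a b (cut_corner v x y)"
    by (rule abs_cont_on_cut_corner[OF ac xy])
  have wd: "is_weak_deriv a b (cut_corner v x y)
      (\<lambda>r. if r \<in> {x<..<y} then (v y - v x) /\<^sub>R (y - x) else weak_deriv a b v r)"
    by (intro is_weak_deriv_cut_corner weak_deriv_is_weak_deriv v xy abs_cont_on_imp_continuous_on ac)
  have W: "cut_corner v x y \<in> W11 a b"
    using wd ac' by (auto simp: W11_def)
  then show "cut_corner v x y \<in> admissible a b (v a) (v b)"
    using xy by (simp add: admissible_def cut_corner_def)
  show "AE r in lebesgue. r \<in> {a<..<b} \<longrightarrow> weak_deriv a b (cut_corner v x y) r =
           (if r \<in> {x<..<y} then (v y - v x) /\<^sub>R (y - x) else weak_deriv a b v r)"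
    using xy by (intro weak_deriv_unique[OF weak_deriv_is_weak_deriv[OF W] wd]
        abs_cont_on_imp_continuous_on ac') auto
qed

text \<open>For an integrable Lagrangian the extended-real action is an ordinary integral, in which the chosen
  version of the weak derivative may be replaced by any other.\<close>
lemma action_eq_integral:
  assumes G: "AE r in lebesgue. r \<in> {a<..<b} \<longrightarrow> weak_deriv a b u r = G r"
    and int: "set_integrable lebesgue {a<..<b} (\<lambda>r. L r (u r) (G r))"
  shows "action a b L u = ereal (LINT r:{a<..<b}|lebesgue. L r (u r) (G r))"
proof -
  define f where "f r = indicator {a<..<b} r *\<^sub>R L r (u r) (G r)" for r
  have f: "integrable lebesgue f"
    using int by (simp add: set_integrable_def f_def[abs_def])
  have pos: "(\<integral>\<^sup>+r\<in>{a<..<b}. ennreal (L r (u r) (weak_deriv a b u r)) \<partial>lebesgue)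
      = (\<integral>\<^sup>+r. ennreal (f r) \<partial>lebesgue)"
  proof (rule nn_integral_cong_AE)
    show "AE r in lebesgue. ennreal (L r (u r) (weak_deriv a b u r)) * indicator {a<..<b} r
        = ennreal (f r)"
      using G by eventually_elim (auto simp: f_def indicator_def)
  qed
  have neg: "(\<integral>\<^sup>+r\<in>{a<..<b}. ennreal (- L r (u r) (weak_deriv a b u r)) \<partial>lebesgue)
      = (\<integral>\<^sup>+r. ennreal (- f r) \<partial>lebesgue)"
  proof (rule nn_integral_cong_AE)
    show "AE r in lebesgue. ennreal (- L r (u r) (weak_deriv a b u r)) * indicator {a<..<b} r
        = ennreal (- f r)"
      using G by eventually_elim (auto simp: f_def indicator_def)
  qed
  have fin: "enn2ereal A = ereal (enn2real A)" if "A \<noteq> \<infinity>" for A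
    using that by (cases A) auto
  have "action a b L u = ereal (integral\<^sup>L lebesgue f)"
    using f unfolding action_def pos neg real_lebesgue_integral_def[OF f]
    by (simp add: fin real_integrable_def)
  then show ?thesis
    by (simp add: set_lebesgue_integral_def f_def[abs_def])
qed

section \<open>Minimizers\<close>

locale action_minimizer =
  fixes a b :: real
    and L :: "real \<Rightarrow> real ^ 'n \<Rightarrow> real ^ 'n \<Rightarrow> real"
    and v :: "real \<Rightarrow> real ^ 'n"
  assumes ab: "a < b"
    and L_cont: "continuous_on ({a..b} \<times> UNIV \<times> UNIV) (\<lambda>(t, y, p). L t y p)"
    and SC: "strict_convexity_SC a b L"
    and v_W11: "v \<in> W11 a b"
    and minimizer: "is_minimizer a b L v"
begin

abbreviation "v' \<equiv> weak_deriv a b v"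

lemma v_cont: "continuous_on {a..b} v"
  using v_W11 by (auto simp: W11_def intro: abs_cont_on_imp_continuous_on)

lemma v'_weak_deriv: "is_weak_deriv a b v v'"
  by (rule weak_deriv_is_weak_deriv[OF v_W11])

lemma v'_integrable: "set_integrable lebesgue {a<..<b} v'"
  using v'_weak_deriv by (simp add: is_weak_deriv_def)

lemma L_compose_continuous:
  assumes "S \<subseteq> {a..b}" "continuous_on S f" "continuous_on S g"
  shows "continuous_on S (\<lambda>r. L r (f r) (g r))"
proof -
  have "continuous_on S (\<lambda>r. (\<lambda>(t, y, p). L t y p) (r, f r, g r))"
    using assms(1) by (intro continuous_on_compose2[OF L_cont] continuous_intros assms) auto
  then show ?thesis by simp
qed

text \<open>The Lagrangian is continuous only for times in \<open>[a, b]\<close>. Multiplying by the indicator of that set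
  gives a Borel function on the whole space, which can be composed with measurable functions.\<close>
lemma L_compose_measurable:
  assumes u: "continuous_on {a..b} u"
    and G: "(\<lambda>r. indicator {a<..<b} r *\<^sub>R G r) \<in> borel_measurable lebesgue"
  shows "(\<lambda>r. indicator {a<..<b} r *\<^sub>R L r (u r) (G r)) \<in> borel_measurable lebesgue"
proof -
  let ?I = "\<lambda>r. indicat_real {a<..<b} r"
  define F where "F z = indicator ({a..b} \<times> UNIV \<times> UNIV) z *\<^sub>R (case z of (t, y, p) \<Rightarrow> L t y p)"
    for z :: "real \<times> (real ^ 'n) \<times> (real ^ 'n)"
  have F: "F \<in> borel_measurable borel"
    unfolding F_def
    by (intro borel_measurable_continuous_on_indicator L_cont borel_closed closed_Times) auto
  have "(\<lambda>r. ?I r *\<^sub>R u r) \<in> borel_measurable borel"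
    by (intro borel_measurable_continuous_on_indicator continuous_on_subset[OF u]) auto
  then have u_meas: "(\<lambda>r. ?I r *\<^sub>R u r) \<in> borel_measurable lebesgue"
    by (simp add: measurable_completion)
  have id_meas: "(\<lambda>r. r) \<in> borel_measurable lebesgue"
    by (simp add: measurable_completion)
  have I_meas: "?I \<in> borel_measurable lebesgue"
    by (intro borel_measurable_indicator) simp
  have "(\<lambda>r. (r, ?I r *\<^sub>R u r, ?I r *\<^sub>R G r)) \<in> borel_measurable lebesgue"
    by (intro borel_measurable_Pair id_meas u_meas G)
  from measurable_compose[OF this F]
  have "(\<lambda>r. ?I r *\<^sub>R F (r, ?I r *\<^sub>R u r, ?I r *\<^sub>R G r)) \<in> borel_measurable lebesgue"
    by (intro borel_measurable_scaleR I_meas)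
  moreover have "?I r *\<^sub>R F (r, ?I r *\<^sub>R u r, ?I r *\<^sub>R G r) = ?I r *\<^sub>R L r (u r) (G r)" for r
    by (auto simp: F_def indicator_def)
  ultimately show ?thesis by (simp only:)
qed

lemma subgradient_exists:
  assumes "r \<in> {a..b}"
  shows "\<exists>\<eta>. is_subgradient (L r y) p \<eta>"
proof -
  define R where "R = max 1 (max \<bar>r\<bar> (max (norm y) (norm p)))"
  have "R \<ge> 1" "max \<bar>r\<bar> (max (norm y) (norm p)) \<le> R + 1"
    by (auto simp: R_def)
  with SC assms show ?thesis
    unfolding strict_convexity_SC_def by meson
qed

text \<open>Convexity bounds the Lagrangian from below by its affine support at velocity zero. The slope \<open>\<eta>\<close> of
  this support is bounded, since moving by a unit vector in its direction raises the support by its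
  norm, while the Lagrangian is bounded on compact sets.\<close>
lemma linear_lower_bound:
  "\<exists>M\<ge>0. \<forall>r\<in>{a..b}. \<forall>q. - (M * (1 + norm q)) \<le> L r (v r) q"
proof -
  let ?F = "\<lambda>(r, q). L r (v r) q" and ?K = "{a..b} \<times> cball 0 1"
  have "compact (?F ` ?K)"
  proof (intro compact_continuous_image compact_Times compact_Icc compact_cball)
    have "continuous_on ?K (\<lambda>z. (\<lambda>(t, y, p). L t y p) (fst z, v (fst z), snd z))"
      by (intro continuous_on_compose2[OF L_cont] continuous_intros continuous_on_compose2[OF v_cont]) auto
    then show "continuous_on ?K ?F"
      by (simp add: case_prod_unfold)
  qed
  from compact_imp_bounded[OF this] obtain B where bound: "\<forall>l\<in>?F ` ?K. norm l \<le> B"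
    unfolding bounded_iff by (rule exE)
  have B: "\<bar>L r (v r) q\<bar> \<le> B" if "r \<in> {a..b}" "norm q \<le> 1" for r q
  proof -
    have "L r (v r) q \<in> ?F ` ?K"
      by (rule image_eqI[of _ _ "(r, q)"]) (use that in auto)
    from bspec[OF bound this] show ?thesis by simp
  qed
  have B0: "0 \<le> B" using B[of a 0] ab by simp
  have "- (2 * B * (1 + norm q)) \<le> L r (v r) q" if r: "r \<in> {a..b}" for r q
  proof -
    obtain \<eta> where \<eta>: "is_subgradient (L r (v r)) 0 \<eta>"
      using subgradient_exists[OF r] by blast
    have "norm \<eta> \<le> 2 * B"
    proof (cases "\<eta> = 0")
      case False
      have "L r (v r) 0 + \<eta> \<bullet> (\<eta> /\<^sub>R norm \<eta>) \<le> L r (v r) (\<eta> /\<^sub>R norm \<eta>)"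
        using \<eta> unfolding is_subgradient_def by (metis diff_zero)
      moreover have "\<eta> \<bullet> (\<eta> /\<^sub>R norm \<eta>) = norm \<eta>"
        using False by (simp add: power2_norm_eq_inner[symmetric] power2_eq_square)
      ultimately show ?thesis
        using B[OF r, of 0] B[OF r, of "\<eta> /\<^sub>R norm \<eta>"] False by (simp add: abs_le_iff)
    qed (use B0 in simp)
    then have "norm \<eta> * norm q \<le> 2 * B * norm q"
      by (rule mult_right_mono) simp
    moreover have "- (norm \<eta> * norm q) \<le> \<eta> \<bullet> q"
      using Cauchy_Schwarz_ineq2[of \<eta> q] by simp
    moreover have "L r (v r) 0 + \<eta> \<bullet> q \<le> L r (v r) q"
      using \<eta> unfolding is_subgradient_def by (metis diff_zero)
    ultimately show ?thesis
      using B[OF r, of 0] B0 by (simp add: abs_le_iff algebra_simps)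
  qed
  with B0 show ?thesis by (intro exI[of _ "2 * B"]) auto
qed

lemma chord_integrand_integrable:
  assumes xy: "a \<le> x" "x < y" "y \<le> b"
  shows "set_integrable lebesgue {x<..<y} (\<lambda>r. L r (chord v x y r) q)"
proof (rule set_integrable_subset)
  have "continuous_on {x..y} (chord v x y)"
    unfolding chord_def by (intro continuous_intros)
  then show "set_integrable lebesgue {x..y} (\<lambda>r. L r (chord v x y r) q)"
    using xy by (intro absolutely_integrable_continuous_real L_compose_continuous continuous_intros) auto
qed auto

text \<open>The negative part is integrable by the linear lower bound. The positive part is integrable because
  the straight line from \<open>v a\<close> to \<open>v b\<close> is a competitor of finite action.\<close>
lemma integrand_integrable: "set_integrable lebesgue {a<..<b} (\<lambda>r. L r (v r) (v' r))"
proof -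
  let ?I = "\<lambda>r. indicat_real {a<..<b} r"
  define f where "f r = ?I r *\<^sub>R L r (v r) (v' r)" for r
  have meas: "f \<in> borel_measurable lebesgue"
    unfolding f_def[abs_def]
    by (intro L_compose_measurable v_cont borel_measurable_integrable)
       (use v'_integrable in \<open>simp add: set_integrable_def\<close>)
  obtain M where M: "M \<ge> 0" "\<And>r q. r \<in> {a..b} \<Longrightarrow> - (M * (1 + norm q)) \<le> L r (v r) q"
    using linear_lower_bound by blast
  have "integrable lebesgue (\<lambda>r. M * (?I r *\<^sub>R 1 + norm (?I r *\<^sub>R v' r)))"
  proof (intro integrable_mult_right Bochner_Integration.integrable_add integrable_norm)
    show "integrable lebesgue (\<lambda>r. ?I r *\<^sub>R (1::real))"
      using ab by (simp add: integrable_indicator_iff)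
    show "integrable lebesgue (\<lambda>r. ?I r *\<^sub>R v' r)"
      using v'_integrable by (simp add: set_integrable_def)
  qed
  then have "(\<integral>\<^sup>+r. ennreal (M * (?I r *\<^sub>R 1 + norm (?I r *\<^sub>R v' r))) \<partial>lebesgue) \<noteq> \<infinity>"
    unfolding real_integrable_def by (elim conjE)
  moreover have "(\<integral>\<^sup>+r. ennreal (- f r) \<partial>lebesgue)
      \<le> (\<integral>\<^sup>+r. ennreal (M * (?I r *\<^sub>R 1 + norm (?I r *\<^sub>R v' r))) \<partial>lebesgue)"
    using M by (intro nn_integral_mono ennreal_leI) (auto simp: f_def indicator_def minus_le_iff)
  ultimately have neg: "(\<integral>\<^sup>+r. ennreal (- f r) \<partial>lebesgue) \<noteq> \<infinity>"
    by (auto simp: top_unique)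
  have "action a b L v \<le> action a b L (cut_corner v a b)"
    using minimizer cut_corner_admissible(1)[OF v_W11 order_refl ab order_refl]
    by (simp add: is_minimizer_def)
  also have "action a b L (cut_corner v a b)
      = ereal (LINT r:{a<..<b}|lebesgue. L r (cut_corner v a b r) ((v b - v a) /\<^sub>R (b - a)))"
  proof (rule action_eq_integral)
    show "AE r in lebesgue. r \<in> {a<..<b} \<longrightarrow>
        weak_deriv a b (cut_corner v a b) r = (v b - v a) /\<^sub>R (b - a)"
      using cut_corner_admissible(2)[OF v_W11 order_refl ab order_refl] by eventually_elim auto
    show "set_integrable lebesgue {a<..<b} (\<lambda>r. L r (cut_corner v a b r) ((v b - v a) /\<^sub>R (b - a)))"
      using chord_integrand_integrable[OF order_refl ab order_refl]
      by (rule iffD1[OF set_integrable_cong, rotated -1]) (auto simp: cut_corner_def)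
  qed
  finally have "action a b L v < \<infinity>" by (auto simp: less_ereal.simps)
  moreover have "action a b L v = enn2ereal (\<integral>\<^sup>+r. ennreal (f r) \<partial>lebesgue)
      - enn2ereal (\<integral>\<^sup>+r. ennreal (- f r) \<partial>lebesgue)"
    unfolding action_def
    by (intro arg_cong2[where f = minus] arg_cong[where f = enn2ereal] nn_integral_cong)
       (auto simp: f_def indicator_def)
  ultimately have "(\<integral>\<^sup>+r. ennreal (f r) \<partial>lebesgue) \<noteq> \<infinity>"
    using neg by (cases "\<integral>\<^sup>+r. ennreal (- f r) \<partial>lebesgue") auto
  with neg meas have "integrable lebesgue f"
    by (simp add: real_integrable_def)
  then show ?thesis
    by (simp add: set_integrable_def f_def[abs_def])
qed

text \<open>Minimality is a statement about the whole of \<open>[a, b]\<close>. The competitor agrees with \<open>v\<close> outside the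
  subinterval, and since all integrals are finite the common part cancels.\<close>
lemma minimizer_le_chord:
  assumes xy: "a \<le> x" "x < y" "y \<le> b"
  shows "(LINT r:{x<..<y}|lebesgue. L r (v r) (v' r))
      \<le> (LINT r:{x<..<y}|lebesgue. L r (chord v x y r) ((v y - v x) /\<^sub>R (y - x)))"
proof -
  define q where "q = (v y - v x) /\<^sub>R (y - x)"
  let ?w = "cut_corner v x y" and ?G = "\<lambda>r. if r \<in> {x<..<y} then q else v' r"
  have sub: "{x<..<y} \<subseteq> {a<..<b}" using xy by auto
  have integrand: "L r (?w r) (?G r)
      = (if r \<in> {x<..<y} then L r (chord v x y r) q else L r (v r) (v' r))" for r
    by (simp add: cut_corner_def)
  have "action a b L v \<le> action a b L ?w"
    using minimizer cut_corner_admissible(1)[OF v_W11 xy] by (simp add: is_minimizer_def)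
  also have "action a b L v = ereal (LINT r:{a<..<b}|lebesgue. L r (v r) (v' r))"
    by (rule action_eq_integral[where G = v']) (simp_all add: integrand_integrable)
  also have "action a b L ?w = ereal (LINT r:{a<..<b}|lebesgue. L r (?w r) (?G r))"
  proof (rule action_eq_integral)
    show "AE r in lebesgue. r \<in> {a<..<b} \<longrightarrow> weak_deriv a b ?w r = ?G r"
      unfolding q_def by (rule cut_corner_admissible(2)[OF v_W11 xy])
    show "set_integrable lebesgue {a<..<b} (\<lambda>r. L r (?w r) (?G r))"
      unfolding integrand
      by (intro set_integral_override_subinterval(1)[OF sub] integrand_integrable chord_integrand_integrable xy)
  qed
  also have "(LINT r:{a<..<b}|lebesgue. L r (?w r) (?G r))
      = (LINT r:{a<..<b}|lebesgue. L r (v r) (v' r)) + (LINT r:{x<..<y}|lebesgue. L r (chord v x y r) q)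
        - (LINT r:{x<..<y}|lebesgue. L r (v r) (v' r))"
    unfolding integrand
    by (intro set_integral_override_subinterval(2)[OF sub] integrand_integrable chord_integrand_integrable xy)
  finally show ?thesis by (simp add: q_def)
qed

text \<open>The vector \<open>\<xi>\<close> is the subgradient at the single point \<open>(t, z, p)\<close>, yet the bound holds for all \<open>(r, y)\<close>
  nearby. For velocities in the ball of radius \<open>c\<close> around \<open>p\<close> this is uniform continuity of the
  Lagrangian on a compact set. In particular most of the gap \<open>2 * \<tau>\<close> survives on the sphere, and
  convexity carries it to all larger velocities, on which there is no uniform control.\<close>
lemma uniform_strict_convexity:
  assumes t: "t \<in> {a..b}" and c: "0 < c"
  obtains \<xi> \<tau> where "0 < \<tau>"
    "\<And>\<epsilon>. 0 < \<epsilon> \<Longrightarrow> \<exists>\<delta>>0. \<forall>r\<in>{a..b}. \<forall>y. \<bar>r - t\<bar> < \<delta> \<longrightarrow> norm (y - z) < \<delta> \<longrightarrow>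
       (\<forall>q. L t z p - \<epsilon> + \<xi> \<bullet> (q - p) + (if c \<le> norm (q - p) then \<tau> else 0) \<le> L r y q)"
proof -
  \<comment> \<open>This size makes the condition apply at \<open>(t, z, p)\<close> and its radius \<open>1 / R\<close> at most \<open>c\<close>.\<close>
  define R where "R = max 1 (max (1 / c) (max \<bar>t\<bar> (max (norm z) (norm p))))"
  have R: "1 \<le> R" "max \<bar>t\<bar> (max (norm z) (norm p)) \<le> R + 1" and "1 / c \<le> R"
    by (auto simp: R_def)
  then have Rc: "inverse R \<le> c"
    using c by (simp add: field_simps)
  from SC R t obtain \<tau> \<xi> where \<tau>: "0 < \<tau>" and \<xi>: "is_subgradient (L t z) p \<xi>"
    and gap: "\<And>q. inverse R \<le> norm (q - p) \<Longrightarrow> L t z p + \<xi> \<bullet> (q - p) + 2 * \<tau> \<le> L t z q"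
    unfolding strict_convexity_SC_def by meson
  show thesis
  proof (rule that[OF \<tau>])
    fix \<epsilon> :: real assume \<epsilon>: "0 < \<epsilon>"
    define e where "e = min \<epsilon> \<tau> / 2"
    have e: "0 < e" "e < \<epsilon>" "2 * e \<le> \<tau>"
      using \<epsilon> \<tau> by (auto simp: e_def)
    let ?K = "{a..b} \<times> cball z 1 \<times> cball p c"
    have "uniformly_continuous_on ?K (\<lambda>(t, y, p). L t y p)"
      by (intro compact_uniformly_continuous continuous_on_subset[OF L_cont] compact_Times
          compact_Icc compact_cball) auto
    with e(1) obtain d where d: "0 < d"
      and unif: "\<And>x x'. x \<in> ?K \<Longrightarrow> x' \<in> ?K \<Longrightarrow> dist x' x < d \<Longrightarrow>
        dist (case x' of (t, y, p) \<Rightarrow> L t y p) (case x of (t, y, p) \<Rightarrow> L t y p) < e"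
      unfolding uniformly_continuous_on_def by meson
    show "\<exists>\<delta>>0. \<forall>r\<in>{a..b}. \<forall>y. \<bar>r - t\<bar> < \<delta> \<longrightarrow> norm (y - z) < \<delta> \<longrightarrow>
       (\<forall>q. L t z p - \<epsilon> + \<xi> \<bullet> (q - p) + (if c \<le> norm (q - p) then \<tau> else 0) \<le> L r y q)"
    proof (intro exI conjI ballI allI impI)
      show "0 < min 1 (d / 2)" using d by simp
      fix r y q assume r: "r \<in> {a..b}" and near: "\<bar>r - t\<bar> < min 1 (d / 2)" "norm (y - z) < min 1 (d / 2)"
      have close: "\<bar>L r y q - L t z q\<bar> < e" if q: "norm (q - p) \<le> c" for q
      proof -
        have "dist (r, y, q) (t, z, q) = sqrt (\<bar>r - t\<bar>\<^sup>2 + (norm (y - z))\<^sup>2)"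
          unfolding dist_Pair_Pair by (simp add: dist_norm)
        also have "\<dots> \<le> \<bar>r - t\<bar> + norm (y - z)"
          by (rule sqrt_sum_squares_le_sum) auto
        also have "\<dots> < d"
          using near by linarith
        finally have "dist (r, y, q) (t, z, q) < d" .
        moreover have "(t, z, q) \<in> ?K" "(r, y, q) \<in> ?K"
          using r t near q by (auto simp: mem_cball dist_norm norm_minus_commute)
        ultimately have "dist (L r y q) (L t z q) < e"
          using unif[of "(t, z, q)" "(r, y, q)"] by simp
        then show ?thesis by (simp add: dist_real_def)
      qed
      have sphere: "L r y p + \<xi> \<bullet> (m - p) + (2 * \<tau> - 2 * e) \<le> L r y m" if "norm (m - p) = c" for m
        using gap[of m] close[of m] close[of p] that Rc c by (simp add: abs_less_iff)
      have outside: "L r y p + \<xi> \<bullet> (q - p) + (2 * \<tau> - 2 * e) \<le> L r y q" if "c \<le> norm (q - p)"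
        by (rule excess_outside_ball[OF subgradient_exists[OF r] c _ sphere that]) (use e \<tau> in simp)
      show "L t z p - \<epsilon> + \<xi> \<bullet> (q - p) + (if c \<le> norm (q - p) then \<tau> else 0) \<le> L r y q"
      proof (cases "c \<le> norm (q - p)")
        case True
        have "L t z p - e < L r y p"
          using close[of p] c by (simp add: abs_less_iff)
        with True outside e show ?thesis by simp
      next
        case False
        then have "L t z p + \<xi> \<bullet> (q - p) \<le> L t z q"
          using \<xi> by (simp add: is_subgradient_def)
        with False show ?thesis
          using close[of q] e by (simp add: abs_less_iff)
      qed
    qed
  qed
qed

section \<open>The set where the derivative is far from the slope\<close>

text \<open>The linear term integrates to an expression in the slope of the chord alone, because \<open>\<xi>\<close> does not
  depend on \<open>r\<close>.\<close>
lemma integral_lower_bound: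
  assumes xy: "a \<le> x" "x < y" "y \<le> b"
    and lower: "\<And>r. r \<in> {x<..<y} \<Longrightarrow>
      K + \<xi> \<bullet> (v' r - p) + (if c \<le> norm (v' r - p) then \<tau> else 0) \<le> L r (v r) (v' r)"
  shows "(K + \<xi> \<bullet> ((v y - v x) /\<^sub>R (y - x) - p)) * (y - x)
      + \<tau> * measure lebesgue {r \<in> {x<..<y}. c \<le> norm (v' r - p)}
    \<le> (LINT r:{x<..<y}|lebesgue. L r (v r) (v' r))"
proof -
  let ?S = "{x<..<y}" and ?D = "{r \<in> {x<..<y}. c \<le> norm (v' r - p)}"
  have sub: "?S \<subseteq> {a<..<b}" using xy by auto
  define G where "G r = indicat_real ?S r *\<^sub>R v' r" for r
  have v'_int: "set_integrable lebesgue ?S v'"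
    by (rule set_integrable_subset[OF v'_integrable _ sub]) simp
  then have G_int: "integrable lebesgue G"
    by (simp add: set_integrable_def G_def[abs_def])
  have G_integral: "(LINT r|lebesgue. G r) = v y - v x"
    using integral_weak_deriv[OF v'_weak_deriv v_cont xy]
    by (simp add: set_lebesgue_integral_def G_def[abs_def])
  have S: "?S \<in> lmeasurable" "measure lebesgue ?S = y - x"
    using xy by simp_all
  have D: "?D \<in> lmeasurable"
  proof (rule fmeasurableI2[OF S(1)])
    have "(\<lambda>r. norm (G r - p)) \<in> borel_measurable lebesgue"
      using borel_measurable_integrable[OF G_int] by measurable
    then have "{r \<in> space lebesgue. c \<le> norm (G r - p)} \<in> sets lebesgue"
      by (intro borel_measurable_le) simp_all
    then have "?S \<inter> {r. c \<le> norm (G r - p)} \<in> sets lebesgue"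
      by (intro sets.Int) simp_all
    also have "?S \<inter> {r. c \<le> norm (G r - p)} = ?D"
      by (auto simp: G_def)
    finally show "?D \<in> sets lebesgue" .
  qed auto
  define l where "l r = (K - \<xi> \<bullet> p) * indicator ?S r + \<xi> \<bullet> G r + \<tau> * indicator ?D r" for r
  have "integrable lebesgue (indicat_real E)" if "E \<in> lmeasurable" for E :: "real set"
    using that by (intro integrable_real_indicator) (auto simp: fmeasurable_def)
  note ind = this[OF S(1)] this[OF D]
  have \<xi>G: "integrable lebesgue (\<lambda>r. \<xi> \<bullet> G r)"
    by (rule integrable_inner_right) (rule G_int)
  note ints = integrable_mult_right[OF ind(1), of "K - \<xi> \<bullet> p"] \<xi>G integrable_mult_right[OF ind(2), of \<tau>]
  have "integral\<^sup>L lebesgue l = (LINT r|lebesgue. (K - \<xi> \<bullet> p) * indicator ?S r)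
      + (LINT r|lebesgue. \<xi> \<bullet> G r) + (LINT r|lebesgue. \<tau> * indicator ?D r)"
    unfolding l_def
    by (simp only: Bochner_Integration.integral_add Bochner_Integration.integrable_add ints)
  also have "\<dots> = (K - \<xi> \<bullet> p) * (y - x) + \<xi> \<bullet> (v y - v x) + \<tau> * measure lebesgue ?D"
  proof -
    have "(LINT r|lebesgue. indicat_real E r) = measure lebesgue E" for E :: "real set"
      by simp
    moreover have "(LINT r|lebesgue. \<xi> \<bullet> G r) = \<xi> \<bullet> (v y - v x)"
      unfolding G_integral[symmetric] by (rule integral_inner_right) (rule G_int)
    ultimately show ?thesis
      by (simp only: integral_mult_right_zero S(2))
  qed
  also have "\<xi> \<bullet> (v y - v x) = (y - x) * (\<xi> \<bullet> ((v y - v x) /\<^sub>R (y - x)))"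
    using xy by (simp only: inner_scaleR_right) simp
  finally have "integral\<^sup>L lebesgue l = (K + \<xi> \<bullet> ((v y - v x) /\<^sub>R (y - x) - p)) * (y - x)
      + \<tau> * measure lebesgue ?D"
    by (simp add: inner_diff_right algebra_simps)
  moreover have "integral\<^sup>L lebesgue l \<le> (LINT r:?S|lebesgue. L r (v r) (v' r))"
    unfolding set_lebesgue_integral_def
  proof (rule integral_mono)
    show "integrable lebesgue l"
      unfolding l_def[abs_def] by (intro Bochner_Integration.integrable_add ints)
    show "integrable lebesgue (\<lambda>r. indicat_real ?S r *\<^sub>R L r (v r) (v' r))"
      using set_integrable_subset[OF integrand_integrable _ sub] by (simp add: set_integrable_def)
    show "l r \<le> indicat_real ?S r *\<^sub>R L r (v r) (v' r)" for r
      using lower[of r] by (auto simp: l_def G_def inner_diff_right indicator_def)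
  qed
  ultimately show ?thesis by linarith
qed

text \<open>Comparing \<open>v\<close> with its chord over a short interval around \<open>t\<close>: the chord costs at most
  \<open>L t (v t) p + \<epsilon>\<close> per unit of time, whereas \<open>v\<close> costs at least \<open>L t (v t) p - \<epsilon>\<close>, up to a small linear
  term, and an additional \<open>\<tau>\<close> wherever its derivative is at distance at least \<open>c\<close> from \<open>p\<close>. Minimality
  leaves little time for the latter.\<close>
lemma measure_derivative_far_small:
  assumes t: "t \<in> {a..b}" and c: "0 < c" and e: "0 < e"
  obtains \<delta> where "0 < \<delta>"
    "\<And>x y. \<lbrakk>a \<le> x; x < y; y \<le> b; t \<in> {x..y}; y - x < \<delta>; norm ((v y - v x) /\<^sub>R (y - x) - p) < \<delta>\<rbrakk>
      \<Longrightarrow> measure lebesgue {r \<in> {x<..<y}. c \<le> norm (v' r - p)} \<le> e * (y - x)"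
proof -
  obtain \<xi> \<tau> where \<tau>: "0 < \<tau>"
    and USC: "\<And>\<epsilon>. 0 < \<epsilon> \<Longrightarrow> \<exists>\<delta>>0. \<forall>r\<in>{a..b}. \<forall>y. \<bar>r - t\<bar> < \<delta> \<longrightarrow> norm (y - v t) < \<delta> \<longrightarrow>
       (\<forall>q. L t (v t) p - \<epsilon> + \<xi> \<bullet> (q - p) + (if c \<le> norm (q - p) then \<tau> else 0) \<le> L r y q)"
    by (rule uniform_strict_convexity[OF t c]) (rule that)
  \<comment> \<open>The error \<open>\<epsilon>\<close> is spent three times: in the lower bound, in the upper bound and on the linear term.\<close>
  define \<epsilon> where "\<epsilon> = e * \<tau> / 3"
  have \<epsilon>: "0 < \<epsilon>" using e \<tau> by (simp add: \<epsilon>_def)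
  from USC[OF \<epsilon>] obtain \<delta>1 where \<delta>1: "0 < \<delta>1" and lower: "\<forall>r\<in>{a..b}. \<forall>y. \<bar>r - t\<bar> < \<delta>1 \<longrightarrow>
       norm (y - v t) < \<delta>1 \<longrightarrow>
       (\<forall>q. L t (v t) p - \<epsilon> + \<xi> \<bullet> (q - p) + (if c \<le> norm (q - p) then \<tau> else 0) \<le> L r y q)"
    by (elim exE conjE)
  obtain d where d: "0 < d" and near: "\<forall>r\<in>{a..b}. \<forall>y q. dist (r, y, q) (t, v t, p) < d \<longrightarrow>
      dist (L r y q) (L t (v t) p) < \<epsilon>"
  proof -
    have "(t, v t, p) \<in> {a..b} \<times> UNIV \<times> UNIV" using t by simp
    from L_cont[unfolded continuous_on_iff, THEN bspec, OF this, THEN spec, THEN mp, OF \<epsilon>]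
    show thesis
      by (elim exE conjE) (rule that, assumption, simp)
  qed
  have upper: "L r y q \<le> L t (v t) p + \<epsilon>"
    if "r \<in> {a..b}" "\<bar>r - t\<bar> < d / 3" "norm (y - v t) < d / 3" "norm (q - p) < d / 3" for r y q
  proof -
    have "dist (r, y, q) (t, v t, p) \<le> norm (r - t) + norm (y - v t, q - p)"
      unfolding dist_norm diff_Pair by (rule norm_Pair_le)
    also have "\<dots> \<le> norm (r - t) + (norm (y - v t) + norm (q - p))"
      by (intro add_left_mono norm_Pair_le)
    also have "\<dots> < d" using that(2-4) by simp
    finally have "dist (L r y q) (L t (v t) p) < \<epsilon>"
      using near that(1) by blast
    then show ?thesis by (simp add: dist_real_def abs_less_iff)
  qed
  define \<rho> where "\<rho> = min \<delta>1 (d / 3)"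
  have \<rho>: "0 < \<rho>" "\<rho> \<le> \<delta>1" "\<rho> \<le> d / 3" using \<delta>1 d by (auto simp: \<rho>_def)
  obtain \<delta>2 where \<delta>2: "0 < \<delta>2" and v_near: "\<And>r. r \<in> {a..b} \<Longrightarrow> \<bar>r - t\<bar> < \<delta>2 \<Longrightarrow> norm (v r - v t) < \<rho>"
    using v_cont[unfolded continuous_on_iff, rule_format, OF t \<rho>(1)]
    by (auto simp: dist_norm dist_real_def)
  define \<delta> where "\<delta> = min (min \<rho> \<delta>2) (\<epsilon> / (norm \<xi> + 1))"
  have \<xi>1: "0 < norm \<xi> + 1"
    using norm_ge_zero[of \<xi>] by linarith
  have \<delta>: "0 < \<delta>" "\<delta> \<le> \<rho>" "\<delta> \<le> \<delta>2" "\<delta> \<le> \<epsilon> / (norm \<xi> + 1)"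
    using \<rho> \<delta>2 \<epsilon> \<xi>1 by (auto simp: \<delta>_def)
  show thesis
  proof (rule that[OF \<delta>(1)])
    fix x y assume xy: "a \<le> x" "x < y" "y \<le> b" and txy: "t \<in> {x..y}" and short: "y - x < \<delta>"
      and slope: "norm ((v y - v x) /\<^sub>R (y - x) - p) < \<delta>"
    define q where "q = (v y - v x) /\<^sub>R (y - x)"
    let ?D = "{r \<in> {x<..<y}. c \<le> norm (v' r - p)}"
    have close: "\<bar>r - t\<bar> < \<delta>" "r \<in> {a..b}" if "r \<in> {x..y}" for r
      using that txy short xy by auto
    have v_close: "norm (v r - v t) < \<rho>" if "r \<in> {x..y}" for r
      using v_near[of r] close[OF that] \<delta>(3) by simp
    have const: "(LINT r:{x<..<y}|lebesgue. C) = C * (y - x)" for C :: real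
      using xy(2) by (simp add: set_lebesgue_integral_def)
    have rearrange: "\<tau> * m \<le> (2 * \<epsilon> - k) * l" if "(K - \<epsilon> + k) * l + \<tau> * m \<le> (K + \<epsilon>) * l"
      for K k l m :: real
      using that by (simp add: algebra_simps)
    have "(L t (v t) p - \<epsilon> + \<xi> \<bullet> (q - p)) * (y - x) + \<tau> * measure lebesgue ?D
        \<le> (LINT r:{x<..<y}|lebesgue. L r (v r) (v' r))"
      unfolding q_def
    proof (rule integral_lower_bound[OF xy])
      fix r assume "r \<in> {x<..<y}"
      then have r: "r \<in> {x..y}" by simp
      show "L t (v t) p - \<epsilon> + \<xi> \<bullet> (v' r - p) + (if c \<le> norm (v' r - p) then \<tau> else 0) \<le> L r (v r) (v' r)"
        using close[OF r] v_close[OF r] \<delta>(2) \<rho>(2) by (intro lower[rule_format]) auto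
    qed
    also have "\<dots> \<le> (LINT r:{x<..<y}|lebesgue. L r (chord v x y r) q)"
      unfolding q_def by (rule minimizer_le_chord[OF xy])
    also have "\<dots> \<le> (LINT r:{x<..<y}|lebesgue. L t (v t) p + \<epsilon>)"
    proof (rule set_integral_mono)
      show "set_integrable lebesgue {x<..<y} (\<lambda>r. L r (chord v x y r) q)"
        by (rule chord_integrand_integrable[OF xy])
      show "set_integrable lebesgue {x<..<y} (\<lambda>r. L t (v t) p + \<epsilon>)"
        by (rule set_integrable_subset[of _ "{x..y}"])
           (auto intro!: absolutely_integrable_continuous_real)
      fix r assume "r \<in> {x<..<y}"
      then have r: "r \<in> {x..y}" by simp
      have "v x \<in> ball (v t) \<rho>" "v y \<in> ball (v t) \<rho>"
        using v_close[of x] v_close[of y] xy(2) by (simp_all add: dist_norm norm_minus_commute)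
      from chord_in_convex[of "ball (v t) \<rho>" v, OF convex_ball this xy(2) r]
      have "norm (chord v x y r - v t) < \<rho>"
        by (simp add: dist_norm norm_minus_commute)
      then show "L r (chord v x y r) q \<le> L t (v t) p + \<epsilon>"
        using slope \<delta>(2) \<rho>(3) close[OF r] unfolding q_def[symmetric] by (intro upper) linarith+
    qed
    also have "\<dots> = (L t (v t) p + \<epsilon>) * (y - x)"
      by (rule const)
    finally have main: "\<tau> * measure lebesgue ?D \<le> (2 * \<epsilon> - \<xi> \<bullet> (q - p)) * (y - x)"
      by (rule rearrange)
    have "- (\<xi> \<bullet> (q - p)) \<le> norm \<xi> * norm (q - p)"
      using Cauchy_Schwarz_ineq2[of \<xi> "q - p"] by simp
    also have "\<dots> \<le> (norm \<xi> + 1) * (\<epsilon> / (norm \<xi> + 1))"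
      using slope \<delta>(4) \<xi>1 unfolding q_def[symmetric] by (intro mult_mono) simp_all
    also have "\<dots> = \<epsilon>" using \<xi>1 by simp
    finally have "2 * \<epsilon> - \<xi> \<bullet> (q - p) \<le> 3 * \<epsilon>" by linarith
    then have "(2 * \<epsilon> - \<xi> \<bullet> (q - p)) * (y - x) \<le> 3 * \<epsilon> * (y - x)"
      using xy(2) by (intro mult_right_mono) simp_all
    also have "\<dots> = \<tau> * (e * (y - x))"
      by (simp add: \<epsilon>_def)
    finally show "measure lebesgue ?D \<le> e * (y - x)"
      using main \<tau> by (meson mult_left_le_imp_le order_trans)
  qed
qed

text \<open>Intersecting with a half-line \<open>S\<close> specialises this to one-sided limits.\<close>
lemma approximate_continuity:
  assumes t: "t \<in> {a..b}" and c: "0 < c"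
    and lim: "((\<lambda>s. (v s - v t) /\<^sub>R (s - t)) \<longlongrightarrow> p) (at t within {a..b} \<inter> S)"
  shows "((\<lambda>s. inverse \<bar>s - t\<bar> * measure lebesgue {r \<in> {min s t<..<max s t}. c \<le> norm (v' r - p)})
           \<longlongrightarrow> 0) (at t within {a..b} \<inter> S)"
proof (rule tendstoI)
  fix e :: real assume "0 < e"
  then have "0 < e / 2" by simp
  then obtain \<delta> where \<delta>: "0 < \<delta>"
    and small: "\<And>x y. \<lbrakk>a \<le> x; x < y; y \<le> b; t \<in> {x..y}; y - x < \<delta>; norm ((v y - v x) /\<^sub>R (y - x) - p) < \<delta>\<rbrakk>
      \<Longrightarrow> measure lebesgue {r \<in> {x<..<y}. c \<le> norm (v' r - p)} \<le> e / 2 * (y - x)"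
    by (rule measure_derivative_far_small[OF t c]) (rule that)
  have "\<forall>\<^sub>F s in at t within {a..b} \<inter> S. s \<in> {a..b} \<inter> S \<and> s \<noteq> t \<and> \<bar>s - t\<bar> < \<delta>"
    using \<delta> unfolding eventually_at by (intro exI[of _ \<delta>]) (auto simp: dist_real_def)
  moreover have "\<forall>\<^sub>F s in at t within {a..b} \<inter> S. norm ((v s - v t) /\<^sub>R (s - t) - p) < \<delta>"
    using tendstoD[OF lim \<delta>] by (simp add: dist_norm)
  ultimately show "\<forall>\<^sub>F s in at t within {a..b} \<inter> S. dist (inverse \<bar>s - t\<bar> *
      measure lebesgue {r \<in> {min s t<..<max s t}. c \<le> norm (v' r - p)}) 0 < e"
  proof eventually_elim
    case (elim s)
    let ?x = "min s t" and ?y = "max s t"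
    have len: "?y - ?x = \<bar>s - t\<bar>" by (simp add: max_def min_def)
    have "(v ?y - v ?x) /\<^sub>R (?y - ?x) = (v s - v t) /\<^sub>R (s - t)"
    proof (cases "s \<le> t")
      case True
      have "(v t - v s) /\<^sub>R (t - s) = (- (v s - v t)) /\<^sub>R (- (s - t))" by simp
      also have "\<dots> = (v s - v t) /\<^sub>R (s - t)"
        by (simp only: inverse_minus_eq scaleR_minus_left scaleR_minus_right minus_minus)
      finally show ?thesis using True by (simp add: max_def min_def)
    qed (simp add: max_def min_def)
    then have "measure lebesgue {r \<in> {?x<..<?y}. c \<le> norm (v' r - p)} \<le> e / 2 * (?y - ?x)"
      using elim t by (intro small) (auto simp: len)
    then have "inverse \<bar>s - t\<bar> * measure lebesgue {r \<in> {?x<..<?y}. c \<le> norm (v' r - p)}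
        \<le> inverse \<bar>s - t\<bar> * (e / 2 * \<bar>s - t\<bar>)"
      unfolding len by (rule mult_left_mono) simp
    also have "\<dots> = e / 2"
      using elim by simp
    finally have half: "inverse \<bar>s - t\<bar> * measure lebesgue {r \<in> {?x<..<?y}. c \<le> norm (v' r - p)} \<le> e / 2" .
    have dist_small: "dist k 0 < e" if "k \<le> e / 2" "0 \<le> k" for k :: real
      using that \<open>0 < e\<close> by (simp add: dist_real_def)
    show ?case
      by (rule dist_small[OF half]) (intro mult_nonneg_nonneg measure_nonneg, simp)
  qed
qed

end

lemma difference_quotient_tendsto:
  fixes v :: "real \<Rightarrow> real ^ 'n"
  assumes "\<And>i. ((\<lambda>s. ereal ((v s $ i - v t $ i) / (s - t))) \<longlongrightarrow> (\<chi> i. ereal (p $ i)) $ i) F"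
  shows "((\<lambda>s. (v s - v t) /\<^sub>R (s - t)) \<longlongrightarrow> p) F"
proof (rule vec_tendstoI)
  fix i
  show "((\<lambda>s. ((v s - v t) /\<^sub>R (s - t)) $ i) \<longlongrightarrow> p $ i) F"
    using assms[of i] by (simp add: divide_inverse mult.commute)
qed

theorem theorem24:
  fixes a b t :: real
    and L :: "real \<Rightarrow> real ^ 'n \<Rightarrow> real ^ 'n \<Rightarrow> real"
    and v :: "real \<Rightarrow> real ^ 'n"
  assumes "a < b"
    and "continuous_on ({a..b} \<times> UNIV \<times> UNIV) (\<lambda>(t, y, p). L t y p)"
    and "strict_convexity_SC a b L"
    and "v \<in> W11 a b"
    and "is_minimizer a b L v"
    and "t \<in> {a..b}"
  shows "(\<forall>p. t \<in> {a<..b} \<and> has_left_deriv v (\<chi> i. ereal (p $ i)) t \<longrightarrow>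
            (\<forall>c>0. ((\<lambda>s. inverse (t - s) *
                 measure lebesgue {r \<in> {s<..<t}. norm (weak_deriv a b v r - p) \<ge> c})
               \<longlongrightarrow> 0) (at_left t)))
       \<and> (\<forall>p. t \<in> {a..<b} \<and> has_right_deriv v (\<chi> i. ereal (p $ i)) t \<longrightarrow>
            (\<forall>c>0. ((\<lambda>s. inverse (s - t) *
                 measure lebesgue {r \<in> {t<..<s}. norm (weak_deriv a b v r - p) \<ge> c})
               \<longlongrightarrow> 0) (at_right t)))"
proof -
  interpret action_minimizer a b L v
    using assms(1-5) by unfold_locales
  let ?far = "\<lambda>p c x y. measure lebesgue {r \<in> {x<..<y}. c \<le> norm (v' r - p)}"
  have left: "((\<lambda>s. inverse (t - s) * ?far p c s t) \<longlongrightarrow> 0) (at_left t)"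
    if t: "t \<in> {a<..b}" and deriv: "has_left_deriv v (\<chi> i. ereal (p $ i)) t" and c: "0 < c" for p c
  proof -
    have filter: "at t within {a..b} \<inter> {..<t} = at_left t"
      using t by (intro at_within_nhd[of _ "{a<..}"]) auto
    have "((\<lambda>s. (v s - v t) /\<^sub>R (s - t)) \<longlongrightarrow> p) (at_left t)"
      by (rule difference_quotient_tendsto[OF spec[OF deriv[unfolded has_left_deriv_def]]])
    then have "((\<lambda>s. inverse \<bar>s - t\<bar> * ?far p c (min s t) (max s t)) \<longlongrightarrow> 0) (at_left t)"
      by (rule approximate_continuity[OF assms(6) c, of p "{..<t}", unfolded filter])
    moreover have "\<forall>\<^sub>F s in at_left t. s < t"
      by (simp add: eventually_at_filter)
    then have "\<forall>\<^sub>F s in at_left t. inverse \<bar>s - t\<bar> * ?far p c (min s t) (max s t)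
        = inverse (t - s) * ?far p c s t"
    proof eventually_elim
      case (elim s)
      then have "\<bar>s - t\<bar> = t - s" "min s t = s" "max s t = t" by simp_all
      then show ?case by (simp only:)
    qed
    ultimately show ?thesis
      by (rule Lim_transform_eventually)
  qed
  have right: "((\<lambda>s. inverse (s - t) * ?far p c t s) \<longlongrightarrow> 0) (at_right t)"
    if t: "t \<in> {a..<b}" and deriv: "has_right_deriv v (\<chi> i. ereal (p $ i)) t" and c: "0 < c" for p c
  proof -
    have filter: "at t within {a..b} \<inter> {t<..} = at_right t"
      using t by (intro at_within_nhd[of _ "{..<b}"]) auto
    have "((\<lambda>s. (v s - v t) /\<^sub>R (s - t)) \<longlongrightarrow> p) (at_right t)"
      by (rule difference_quotient_tendsto[OF spec[OF deriv[unfolded has_right_deriv_def]]])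
    then have "((\<lambda>s. inverse \<bar>s - t\<bar> * ?far p c (min s t) (max s t)) \<longlongrightarrow> 0) (at_right t)"
      by (rule approximate_continuity[OF assms(6) c, of p "{t<..}", unfolded filter])
    moreover have "\<forall>\<^sub>F s in at_right t. t < s"
      by (simp add: eventually_at_filter)
    then have "\<forall>\<^sub>F s in at_right t. inverse \<bar>s - t\<bar> * ?far p c (min s t) (max s t)
        = inverse (s - t) * ?far p c t s"
    proof eventually_elim
      case (elim s)
      then have "\<bar>s - t\<bar> = s - t" "min s t = t" "max s t = s" by simp_all
      then show ?case by (simp only:)
    qed
    ultimately show ?thesis
      by (rule Lim_transform_eventually)
  qed
  show ?thesis
    by (intro conjI allI impI; elim conjE) (rule left right; assumption)+
qed

end
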